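(* Let $(\mathbf{x}^k)_{k\ge 1}$ be the sequence generated by Adam (as defined in the context). Assume: (i) $\mathbb{E}[\mathbf{g}^k\mid\mathcal{F}^k]=\nabla f(\mathbf{x}^k)$ for all $k\ge1$, and there exists $M>0$ such that $\|\mathbf{g}^k\|\le M$ almost surely for all $k\ge1$; (ii) $f$ is bounded below, with $f^*:=\inf_{\mathbf{x}\in\mathbb{R}^d} f(\mathbf{x})>-\infty$, and $f$ is $L$-smooth for some $L>0$, i.e. $\|\nabla f(\mathbf{x})-\nabla f(\mathbf{y})\|\le L\|\mathbf{x}-\mathbf{y}\|$ for all $\mathbf{x},\mathbf{y}\in\mathbb{R}^d$; (iii) $(\eta_k)_{k\ge1}$ is decreasing and $$\sum_{k=2}^{\infty}\frac{\eta_k}{\sum_{i=1}^{k-1}\eta_i}=\infty,\qquad \sum_{k=1}^{\infty}\eta_k^2<\infty,\qquad \sum_{k=1}^{\infty}\eta_k(1-\theta_k)<\infty.$$ Then, almost surely, as $K\to\infty$, $$\min_{1\le k\le K}\|\nabla f(\mathbf{x}^k)\|^2=o\left(\frac{1}{\sum_{k=1}^{K}\eta_k}\right).$$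
   Context: Setting: $f:\mathbb{R}^d\to\mathbb{R}$ is differentiable, $f(\mathbf{x})=\mathbb{E}_{\xi\sim\mathbb{P}}[\ell(\mathbf{x};\xi)]$. All vector operations (powers, square roots, products, quotients, adding a scalar) are element-wise; $\|\cdot\|$ is the Euclidean norm. Adam: given deterministic parameters $\eta_k>0$ (step size), $\epsilon>0$, $0\le\beta_k\le\beta<1$, $\theta_k\in(0,1)$ for $k\ge1$, initialize $\mathbf{m}^0=\mathbf{0}$, $\mathbf{v}^0=\mathbf{0}$, $\mathbf{x}^1\in\mathbb{R}^d$ (deterministic). For $k=1,2,\dots$: sample the stochastic gradient $\mathbf{g}^k=\nabla\ell(\mathbf{x}^k;\xi^k)$, where $\xi^k$ is the random data sample drawn at iteration $k$, and set $$\mathbf{m}^k=\beta_k\mathbf{m}^{k-1}+(1-\beta_k)\mathbf{g}^k,\quad \mathbf{v}^k=\theta_k\mathbf{v}^{k-1}+(1-\theta_k)(\mathbf{g}^k)^2,\quad \mathbf{x}^{k+1}=\mathbf{x}^k-\eta_k\frac{\mathbf{m}^k}{\sqrt{\mathbf{v}^k+\epsilon}}.$$ $\mathcal{F}^k:=\sigma(\mathbf{x}^1,\dots,\mathbf{x}^k)$. *)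

theory Defs
  imports "HOL-Probability.Probability"
begin

definition past_sigma :: "'w measure \<Rightarrow> (nat \<Rightarrow> 'w \<Rightarrow> 'b::topological_space) \<Rightarrow> nat \<Rightarrow> 'w measure"
  where "past_sigma M x k =
    sigma (space M) (\<Union>i\<in>{1..k}. {x i -` A \<inter> space M | A. A \<in> sets borel})"

text \<open>
  The library's conditional expectation is real-valued, so a random vector is conditioned
  coordinatewise.
\<close>

definition vec_cond_exp ::
    "'w measure \<Rightarrow> 'w measure \<Rightarrow> ('w \<Rightarrow> real ^ 'd) \<Rightarrow> 'w \<Rightarrow> real ^ 'd"
  where "vec_cond_exp M F X \<omega> = (\<chi> i. real_cond_exp M F (\<lambda>\<omega>'. X \<omega>' $ i) \<omega>)"

text \<open>
  All sequences except \<open>m\<close> and \<open>v\<close> are indexed from 1; their values at 0 are irrelevant.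
  No law or independence is imposed on the samples \<open>\<xi> k\<close>: how they relate to \<open>f\<close> is left to
  the unbiasedness hypothesis on \<open>g\<close>, which is not part of this locale.
  Only differentiability of \<open>loss\<close> at the sampled points is required, as this is what gives
  meaning to \<open>g k\<close> being the gradient of \<open>loss\<close> at \<open>x k\<close>.
\<close>

locale adam = M: prob_space M + P: prob_space P
  for M :: "'w measure" and P :: "'s measure" +
  fixes loss :: "real ^ 'd \<Rightarrow> 's \<Rightarrow> real"
    and f :: "real ^ 'd \<Rightarrow> real"
    and \<xi> :: "nat \<Rightarrow> 'w \<Rightarrow> 's"
    and \<eta> :: "nat \<Rightarrow> real"
    and \<epsilon> :: real
    and \<beta> :: "nat \<Rightarrow> real"
    and \<beta>bar :: real
    and \<theta> :: "nat \<Rightarrow> real"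
    and x1 :: "real ^ 'd"
    and g m v x :: "nat \<Rightarrow> 'w \<Rightarrow> real ^ 'd"
  assumes loss_integrable: "\<And>y. integrable P (loss y)"
    and objective: "\<And>y. f y = (\<integral>s. loss y s \<partial>P)"
    and step_size_pos: "\<And>k. 1 \<le> k \<Longrightarrow> 0 < \<eta> k"
    and eps_pos: "0 < \<epsilon>"
    and beta_range: "\<And>k. 1 \<le> k \<Longrightarrow> 0 \<le> \<beta> k \<and> \<beta> k \<le> \<beta>bar"
    and beta_bar: "\<beta>bar < 1"
    and theta_range: "\<And>k. 1 \<le> k \<Longrightarrow> 0 < \<theta> k \<and> \<theta> k < 1"
    and sample_measurable: "\<And>k. 1 \<le> k \<Longrightarrow> \<xi> k \<in> measurable M P"
    and grad_measurable: "\<And>k. 1 \<le> k \<Longrightarrow> g k \<in> borel_measurable M"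
    and stochastic_grad: "\<And>k \<omega>. 1 \<le> k \<Longrightarrow> \<omega> \<in> space M \<Longrightarrow>
          GDERIV (\<lambda>y. loss y (\<xi> k \<omega>)) (x k \<omega>) :> g k \<omega>"
    and init_m: "\<And>\<omega>. \<omega> \<in> space M \<Longrightarrow> m 0 \<omega> = 0"
    and init_v: "\<And>\<omega>. \<omega> \<in> space M \<Longrightarrow> v 0 \<omega> = 0"
    and init_x: "\<And>\<omega>. \<omega> \<in> space M \<Longrightarrow> x 1 \<omega> = x1"
    and step_m: "\<And>k \<omega>. 1 \<le> k \<Longrightarrow> \<omega> \<in> space M \<Longrightarrow>
          m k \<omega> = \<beta> k *\<^sub>R m (k - 1) \<omega> + (1 - \<beta> k) *\<^sub>R g k \<omega>"
    and step_v: "\<And>k \<omega>. 1 \<le> k \<Longrightarrow> \<omega> \<in> space M \<Longrightarrow>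
          v k \<omega> = (\<chi> i. \<theta> k * v (k - 1) \<omega> $ i + (1 - \<theta> k) * (g k \<omega> $ i)\<^sup>2)"
    and step_x: "\<And>k \<omega>. 1 \<le> k \<Longrightarrow> \<omega> \<in> space M \<Longrightarrow>
          x (k + 1) \<omega> = (\<chi> i. x k \<omega> $ i - \<eta> k * (m k \<omega> $ i / sqrt (v k \<omega> $ i + \<epsilon>)))"

end

theory Submission
  imports Defs
begin

text \<open>
  Since \<open>v (k - 1)\<close> may fail to be measurable with respect to the past \<open>F k = \<sigma>(x 1, \<dots>, x k)\<close>,
  the usual replacement of \<open>v k\<close> by \<open>v (k - 1)\<close> does not decouple the preconditioner from
  \<open>g k\<close>. Work coordinatewise with \<open>u k = sqrt (v k + \<epsilon>)\<close> and the normalised step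
  \<open>s k = m k / u k\<close>, which is \<open>F (k + 1)\<close>-measurable because it is \<open>(x k - x (k + 1)) / \<eta> k\<close>,
  and average the preconditioner: \<open>U k = E[u k | F (k + 1)]\<close>. Testing
  \<open>(1 - \<beta> k) g k = u k s k - \<beta> k u (k - 1) s (k - 1)\<close> against \<open>p k / U (k - 1)\<close>, where \<open>p k\<close> is the
  partial derivative of \<open>f\<close> at \<open>x k\<close>, gives
  \<open>E[p k s k] \<ge> \<beta> k E[p k s (k - 1)] + c E[(p k)\<^sup>2] - C E[(U k - U (k - 1))\<^sup>2]\<close>. Up to multiples of
  \<open>1 - \<theta> k\<close>, \<open>U\<close> is a bounded martingale, so \<open>E[(U k - U (k - 1))\<^sup>2]\<close> is at most the increment of
  \<open>E[(U k)\<^sup>2]\<close>, and its sum with the decreasing weights \<open>\<eta> k\<close> is finite. Together with the descent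
  inequality for \<open>f\<close> this makes the sum of \<open>\<eta> k E[\<bar>grad f (x k)\<bar>\<^sup>2]\<close> finite, hence the sum of
  \<open>\<eta> k \<bar>grad f (x k)\<bar>\<^sup>2\<close> almost surely, and its tails bound the running minimum times the sum of
  the \<open>\<eta> k\<close>, which diverges.
\<close>

subsection \<open>Conditioning on increasing information\<close>

text \<open>The variables averaged below are bounded almost surely. Unlike integrability, this
  property survives products, so it settles the integrability side conditions uniformly.\<close>

definition ess_bounded :: "'w measure \<Rightarrow> ('w \<Rightarrow> real) \<Rightarrow> bool"
  where "ess_bounded M X \<longleftrightarrow> X \<in> borel_measurable M \<and> (\<exists>B. AE \<omega> in M. \<bar>X \<omega>\<bar> \<le> B)"

lemma ess_boundedI:
  assumes "X \<in> borel_measurable M" and "AE \<omega> in M. \<bar>X \<omega>\<bar> \<le> B"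
  shows "ess_bounded M X"
  using assms unfolding ess_bounded_def by blast

lemma ess_bounded_add:
  assumes "ess_bounded M X" and "ess_bounded M Y"
  shows "ess_bounded M (\<lambda>\<omega>. X \<omega> + Y \<omega>)"
proof -
  obtain A B where A: "AE \<omega> in M. \<bar>X \<omega>\<bar> \<le> A" and B: "AE \<omega> in M. \<bar>Y \<omega>\<bar> \<le> B"
    using assms unfolding ess_bounded_def by blast
  have "AE \<omega> in M. \<bar>X \<omega> + Y \<omega>\<bar> \<le> A + B"
    using A B by eventually_elim linarith
  then show ?thesis
    using assms unfolding ess_bounded_def by auto
qed

lemma ess_bounded_mult:
  assumes "ess_bounded M X" and "ess_bounded M Y"
  shows "ess_bounded M (\<lambda>\<omega>. X \<omega> * Y \<omega>)"
proof -
  obtain A B where A: "AE \<omega> in M. \<bar>X \<omega>\<bar> \<le> A" and B: "AE \<omega> in M. \<bar>Y \<omega>\<bar> \<le> B"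
    using assms unfolding ess_bounded_def by blast
  have "AE \<omega> in M. \<bar>X \<omega> * Y \<omega>\<bar> \<le> A * B"
    using A B by eventually_elim (simp add: abs_mult mult_mono')
  then show ?thesis
    using assms unfolding ess_bounded_def by auto
qed

lemma ess_bounded_const: "ess_bounded M (\<lambda>\<omega>. c)"
  by (rule ess_boundedI[where B = "\<bar>c\<bar>"]) auto

lemma ess_bounded_diff:
  assumes "ess_bounded M X" and "ess_bounded M Y"
  shows "ess_bounded M (\<lambda>\<omega>. X \<omega> - Y \<omega>)"
  using ess_bounded_add[OF assms(1) ess_bounded_mult[OF ess_bounded_const[of M "-1"] assms(2)]]
  by simp

lemma ess_bounded_square:
  assumes "ess_bounded M X"
  shows "ess_bounded M (\<lambda>\<omega>. (X \<omega>)\<^sup>2)"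
  unfolding power2_eq_square by (rule ess_bounded_mult[OF assms assms])

lemmas ess_bounded_intros =
  ess_bounded_add ess_bounded_mult ess_bounded_const ess_bounded_diff ess_bounded_square

lemma (in finite_measure) ess_bounded_integrable:
  assumes "ess_bounded M X"
  shows "integrable M X"
  using assms integrable_const_bound[of X] unfolding ess_bounded_def by auto

section \<open>Conditional expectations of bounded variables\<close>

lemma (in prob_space) subalgebra_sigma_finite:
  assumes "subalgebra M F"
  shows "sigma_finite_subalgebra M F"
  by (intro finite_measure_subalgebra_is_sigma_finite)
    (simp add: finite_measure_axioms finite_measure_subalgebra_axioms_def
      finite_measure_subalgebra_def assms)

lemma (in prob_space) cond_exp_bounds:
  assumes F: "subalgebra M F"
    and u: "u \<in> borel_measurable M" "AE \<omega> in M. a \<le> u \<omega> \<and> u \<omega> \<le> b"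
  shows "AE \<omega> in M. a \<le> real_cond_exp M F u \<omega> \<and> real_cond_exp M F u \<omega> \<le> b"
proof -
  interpret sigma_finite_subalgebra M F
    by (rule subalgebra_sigma_finite[OF F])
  have "AE \<omega> in M. \<bar>u \<omega>\<bar> \<le> \<bar>a\<bar> + \<bar>b\<bar>"
    using u(2) by eventually_elim auto
  then have int: "integrable M u"
    using u(1) by (intro ess_bounded_integrable ess_boundedI)
  have "AE \<omega> in M. a \<le> real_cond_exp M F u \<omega>"
    using u(2) by (intro real_cond_exp_ge_c[OF int]) auto
  moreover have "AE \<omega> in M. real_cond_exp M F u \<omega> \<le> b"
    using u(2) by (intro real_cond_exp_le_c[OF int]) auto
  ultimately show ?thesis by eventually_elim simp
qed

text \<open>Averaging against an \<open>F\<close>-measurable weight does not distinguish a variable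
  from its conditional expectation. The exchanges of \<open>u\<close> for \<open>U\<close>,
  \<open>u'\<close> for \<open>W\<close> and \<open>g\<close> for \<open>p\<close> below are
  instances.\<close>

lemma (in prob_space) integral_mult_cond_exp:
  assumes "subalgebra M F" "Z \<in> borel_measurable F" "ess_bounded M Z" "ess_bounded M X"
  shows "(\<integral>\<omega>. Z \<omega> * real_cond_exp M F X \<omega> \<partial>M) = (\<integral>\<omega>. Z \<omega> * X \<omega> \<partial>M)"
proof -
  interpret sigma_finite_subalgebra M F
    by (rule subalgebra_sigma_finite[OF assms(1)])
  show ?thesis
    using assms ess_bounded_integrable[OF ess_bounded_mult[OF assms(3,4)]]
    by (intro real_cond_exp_intg(2)) (auto simp: ess_bounded_def)
qed

text \<open>One coordinate of one Adam step: \<open>F\<close> and \<open>H\<close> are the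
  information before and after the step, \<open>u'\<close> and \<open>u\<close> the old and new
  roots of the second moment. These roots are only taken to be measurable for \<open>M\<close>, so
  the averages \<open>W\<close> and \<open>U\<close> stand in for them.\<close>

locale preconditioner_step = prob_space M
  for M :: "'w measure" +
  fixes F H :: "'w measure" and u u' :: "'w \<Rightarrow> real" and a b :: real
  assumes subalgebra_F: "subalgebra M F"
    and subalgebra_H: "subalgebra M H"
    and subalgebra_HF: "subalgebra H F"
    and u_measurable: "u \<in> borel_measurable M"
    and u'_measurable: "u' \<in> borel_measurable M"
    and u_bounds: "AE \<omega> in M. a \<le> u \<omega> \<and> u \<omega> \<le> b"
    and u'_bounds: "AE \<omega> in M. a \<le> u' \<omega> \<and> u' \<omega> \<le> b"
    and a_pos: "0 < a"
begin

abbreviation "U \<equiv> real_cond_exp M H u"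
abbreviation "W \<equiv> real_cond_exp M F u'"

lemma U_bounds: "AE \<omega> in M. a \<le> U \<omega> \<and> U \<omega> \<le> b"
  by (rule cond_exp_bounds[OF subalgebra_H u_measurable u_bounds])

lemma W_bounds: "AE \<omega> in M. a \<le> W \<omega> \<and> W \<omega> \<le> b"
  by (rule cond_exp_bounds[OF subalgebra_F u'_measurable u'_bounds])

lemma W_measurable_H: "W \<in> borel_measurable H"
  by (rule measurable_from_subalg[OF subalgebra_HF borel_measurable_cond_exp])

lemma a_le_b: "a \<le> b"
proof -
  have "AE \<omega> in M. a \<le> b"
    using u_bounds by eventually_elim linarith
  then show ?thesis by simp
qed

lemma ess_bounded_facts:
  "ess_bounded M u" "ess_bounded M u'" "ess_bounded M U" "ess_bounded M W"
proof -
  have bounded: "ess_bounded M X"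
    if "X \<in> borel_measurable M" "AE \<omega> in M. a \<le> X \<omega> \<and> X \<omega> \<le> b" for X
    using that(2) by (intro ess_boundedI[OF that(1), where B = b], eventually_elim) (use a_pos in auto)
  show "ess_bounded M u" "ess_bounded M u'" "ess_bounded M U" "ess_bounded M W"
    using bounded u_measurable u'_measurable u_bounds u'_bounds U_bounds W_bounds by auto
qed

text \<open>Expand the square. As \<open>W\<close> is \<open>H\<close>-measurable, the cross term is
  the mean of \<open>W * u\<close>, while the mean of \<open>W\<^sup>2\<close> is that of
  \<open>W * u'\<close>, which exceeds the former by at most \<open>b * e\<close>. For
  \<open>e = 0\<close> this is the orthogonality of martingale increments.\<close>

lemma increment_second_moment:
  assumes diff: "AE \<omega> in M. \<bar>u \<omega> - u' \<omega>\<bar> \<le> e"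
  shows "(\<integral>\<omega>. (U \<omega> - W \<omega>)\<^sup>2 \<partial>M) \<le> (\<integral>\<omega>. (U \<omega>)\<^sup>2 \<partial>M) - (\<integral>\<omega>. (W \<omega>)\<^sup>2 \<partial>M) + 2 * b * e"
proof -
  note ebs = ess_bounded_integrable ess_bounded_intros ess_bounded_facts
  have WU: "(\<integral>\<omega>. W \<omega> * U \<omega> \<partial>M) = (\<integral>\<omega>. W \<omega> * u \<omega> \<partial>M)"
    by (intro integral_mult_cond_exp[OF subalgebra_H W_measurable_H] ebs)
  have WW: "(\<integral>\<omega>. W \<omega> * W \<omega> \<partial>M) = (\<integral>\<omega>. W \<omega> * u' \<omega> \<partial>M)"
    by (intro integral_mult_cond_exp[OF subalgebra_F borel_measurable_cond_exp] ebs)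
  have "AE \<omega> in M. W \<omega> * u' \<omega> - W \<omega> * u \<omega> \<le> b * e"
    using diff W_bounds
  proof eventually_elim
    case (elim \<omega>)
    have "W \<omega> * u' \<omega> - W \<omega> * u \<omega> \<le> W \<omega> * \<bar>u \<omega> - u' \<omega>\<bar>"
      unfolding right_diff_distrib[symmetric] using elim a_pos by (intro mult_left_mono) auto
    also have "\<dots> \<le> b * e"
      using elim a_pos by (intro mult_mono) auto
    finally show ?case .
  qed
  then have "(\<integral>\<omega>. W \<omega> * u' \<omega> - W \<omega> * u \<omega> \<partial>M) \<le> b * e"
    by (intro integral_le_const ebs)
  then have le: "(\<integral>\<omega>. W \<omega> * u' \<omega> \<partial>M) - (\<integral>\<omega>. W \<omega> * u \<omega> \<partial>M) \<le> b * e"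
    by (subst (asm) Bochner_Integration.integral_diff) (intro ebs)+
  have "(\<integral>\<omega>. (U \<omega> - W \<omega>)\<^sup>2 \<partial>M) = (\<integral>\<omega>. ((U \<omega>)\<^sup>2 + W \<omega> * W \<omega>) - 2 * (W \<omega> * U \<omega>) \<partial>M)"
    by (intro Bochner_Integration.integral_cong) (auto simp: power2_eq_square algebra_simps)
  also have "\<dots> = (\<integral>\<omega>. (U \<omega>)\<^sup>2 + W \<omega> * W \<omega> \<partial>M) - (\<integral>\<omega>. 2 * (W \<omega> * U \<omega>) \<partial>M)"
    by (intro Bochner_Integration.integral_diff ebs)
  also have "(\<integral>\<omega>. (U \<omega>)\<^sup>2 + W \<omega> * W \<omega> \<partial>M) = (\<integral>\<omega>. (U \<omega>)\<^sup>2 \<partial>M) + (\<integral>\<omega>. W \<omega> * W \<omega> \<partial>M)"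
    by (intro Bochner_Integration.integral_add ebs)
  finally show ?thesis
    using le WU WW by (simp add: power2_eq_square)
qed

text \<open>The recursion is tested against \<open>p / W\<close>. The momentum term becomes the mean
  of \<open>p * s'\<close>, and unbiasedness turns the gradient term into a gain of at least
  \<open>c\<close> times the mean of \<open>p\<^sup>2\<close>. The left side is the mean of
  \<open>p * s\<close> distorted by \<open>U / W\<close>; this mismatch is paid for with half of the
  gain and a multiple of \<open>(U - W)\<^sup>2\<close>.\<close>

lemma expected_descent:
  assumes s: "s \<in> borel_measurable H" "AE \<omega> in M. \<bar>s \<omega>\<bar> \<le> S"
    and s': "s' \<in> borel_measurable F" "AE \<omega> in M. \<bar>s' \<omega>\<bar> \<le> S"
    and p: "p \<in> borel_measurable F" "AE \<omega> in M. \<bar>p \<omega>\<bar> \<le> G"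
    and g: "ess_bounded M g" "AE \<omega> in M. real_cond_exp M F g \<omega> = p \<omega>"
    and recursion: "AE \<omega> in M. u \<omega> * s \<omega> = \<beta> * (u' \<omega> * s' \<omega>) + (1 - \<beta>) * g \<omega>"
    and \<beta>: "\<beta> \<le> \<beta>bar" "\<beta>bar < 1"
  defines "c \<equiv> (1 - \<beta>bar) / b"
  shows "\<beta> * (\<integral>\<omega>. p \<omega> * s' \<omega> \<partial>M) + c / 2 * (\<integral>\<omega>. (p \<omega>)\<^sup>2 \<partial>M)
      - (S / a)\<^sup>2 / (2 * c) * (\<integral>\<omega>. (U \<omega> - W \<omega>)\<^sup>2 \<partial>M) \<le> (\<integral>\<omega>. p \<omega> * s \<omega> \<partial>M)"
proof -
  have b: "0 < b" using a_pos a_le_b by linarith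
  have c: "0 < c" using b \<beta> by (simp add: c_def)
  \<comment> \<open>Dividing by \<open>W\<close> rather than \<open>u'\<close> keeps the test
    function \<open>F\<close>-measurable, so it can be paired with the conditional mean of
    \<open>g\<close>, and it still cancels \<open>u'\<close> on average.\<close>
  define q where "q \<omega> = p \<omega> * inverse (W \<omega>)" for \<omega>
  have pH: "p \<in> borel_measurable H"
    by (rule measurable_from_subalg[OF subalgebra_HF p(1)])
  have qF: "q \<in> borel_measurable F"
    unfolding q_def using p(1) by measurable
  have qH: "q \<in> borel_measurable H"
    by (rule measurable_from_subalg[OF subalgebra_HF qF])
  have bs: "ess_bounded M s"
    by (rule ess_boundedI[OF measurable_from_subalg[OF subalgebra_H s(1)] s(2)])
  have bs': "ess_bounded M s'"
    by (rule ess_boundedI[OF measurable_from_subalg[OF subalgebra_F s'(1)] s'(2)])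
  have bp: "ess_bounded M p"
    by (rule ess_boundedI[OF measurable_from_subalg[OF subalgebra_F p(1)] p(2)])
  have bq: "ess_bounded M q"
    unfolding q_def
  proof (rule ess_bounded_mult[OF bp ess_boundedI])
    show "AE \<omega> in M. \<bar>inverse (W \<omega>)\<bar> \<le> inverse a"
      using W_bounds a_pos by (auto elim!: eventually_mono intro!: le_imp_inverse_le)
  qed measurable
  note ebs = ess_bounded_integrable ess_bounded_intros ess_bounded_facts bs bs' bp bq g(1)
  have "(\<integral>\<omega>. q \<omega> * real_cond_exp M F g \<omega> \<partial>M) = (\<integral>\<omega>. q \<omega> * g \<omega> \<partial>M)"
    by (intro integral_mult_cond_exp[OF subalgebra_F qF] ebs)
  moreover have "(\<integral>\<omega>. q \<omega> * real_cond_exp M F g \<omega> \<partial>M) = (\<integral>\<omega>. q \<omega> * p \<omega> \<partial>M)"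
  proof (rule integral_cong_AE)
    show "AE \<omega> in M. q \<omega> * real_cond_exp M F g \<omega> = q \<omega> * p \<omega>"
      using g(2) by eventually_elim simp
    show "(\<lambda>\<omega>. q \<omega> * real_cond_exp M F g \<omega>) \<in> borel_measurable M"
      by (intro borel_measurable_times borel_measurable_cond_exp2)
        (use bq in \<open>simp add: ess_bounded_def\<close>)
  qed (intro borel_measurable_integrable ebs)+
  ultimately have qg: "(\<integral>\<omega>. q \<omega> * g \<omega> \<partial>M) = (\<integral>\<omega>. q \<omega> * p \<omega> \<partial>M)"
    by simp
  \<comment> \<open>\<open>q * s\<close> is known only after the step, so \<open>u\<close> is
    averaged over \<open>H\<close>. In the next identity \<open>q * s'\<close> is known before it,
    so \<open>u'\<close> is averaged over \<open>F\<close> and \<open>W\<close> cancels.\<close>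
  have qu: "(\<integral>\<omega>. (q \<omega> * s \<omega>) * U \<omega> \<partial>M) = (\<integral>\<omega>. (q \<omega> * s \<omega>) * u \<omega> \<partial>M)"
    by (intro integral_mult_cond_exp[OF subalgebra_H] borel_measurable_times ebs qH s(1))
  have "(\<integral>\<omega>. (q \<omega> * s' \<omega>) * W \<omega> \<partial>M) = (\<integral>\<omega>. (q \<omega> * s' \<omega>) * u' \<omega> \<partial>M)"
    by (intro integral_mult_cond_exp[OF subalgebra_F] borel_measurable_times ebs qF s'(1))
  moreover have "(\<integral>\<omega>. (q \<omega> * s' \<omega>) * W \<omega> \<partial>M) = (\<integral>\<omega>. p \<omega> * s' \<omega> \<partial>M)"
  proof (rule integral_cong_AE)
    show "AE \<omega> in M. (q \<omega> * s' \<omega>) * W \<omega> = p \<omega> * s' \<omega>"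
      using W_bounds by eventually_elim (use a_pos in \<open>auto simp: q_def field_simps\<close>)
  qed (intro borel_measurable_integrable ebs)+
  ultimately have qu': "(\<integral>\<omega>. (q \<omega> * s' \<omega>) * u' \<omega> \<partial>M) = (\<integral>\<omega>. p \<omega> * s' \<omega> \<partial>M)"
    by simp
  have "(\<integral>\<omega>. (q \<omega> * s \<omega>) * u \<omega> \<partial>M)
      = (\<integral>\<omega>. \<beta> * ((q \<omega> * s' \<omega>) * u' \<omega>) + (1 - \<beta>) * (q \<omega> * g \<omega>) \<partial>M)"
  proof (rule integral_cong_AE)
    show "AE \<omega> in M. (q \<omega> * s \<omega>) * u \<omega> = \<beta> * ((q \<omega> * s' \<omega>) * u' \<omega>) + (1 - \<beta>) * (q \<omega> * g \<omega>)"
      using recursion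
    proof eventually_elim
      case (elim \<omega>)
      have "(q \<omega> * s \<omega>) * u \<omega> = q \<omega> * (u \<omega> * s \<omega>)" by simp
      also have "\<dots> = \<beta> * ((q \<omega> * s' \<omega>) * u' \<omega>) + (1 - \<beta>) * (q \<omega> * g \<omega>)"
        unfolding elim by (simp add: algebra_simps)
      finally show ?case .
    qed
  qed (intro borel_measurable_integrable ebs)+
  also have "\<dots> = \<beta> * (\<integral>\<omega>. p \<omega> * s' \<omega> \<partial>M) + (1 - \<beta>) * (\<integral>\<omega>. q \<omega> * p \<omega> \<partial>M)"
    unfolding qg[symmetric] qu'[symmetric]
    by (subst Bochner_Integration.integral_add, (intro ebs)+) simp
  finally have key: "(\<integral>\<omega>. (q \<omega> * s \<omega>) * U \<omega> \<partial>M)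
      = \<beta> * (\<integral>\<omega>. p \<omega> * s' \<omega> \<partial>M) + (1 - \<beta>) * (\<integral>\<omega>. q \<omega> * p \<omega> \<partial>M)"
    unfolding qu .
  have "(\<integral>\<omega>. (p \<omega>)\<^sup>2 / b \<partial>M) \<le> (\<integral>\<omega>. q \<omega> * p \<omega> \<partial>M)"
  proof (rule integral_mono_AE)
    show "AE \<omega> in M. (p \<omega>)\<^sup>2 / b \<le> q \<omega> * p \<omega>"
      using W_bounds
    proof eventually_elim
      case (elim \<omega>)
      have "(p \<omega>)\<^sup>2 / b \<le> (p \<omega>)\<^sup>2 / W \<omega>"
        using elim a_pos b by (intro divide_left_mono) auto
      then show ?case by (simp add: q_def power2_eq_square field_simps)
    qed
  qed (use b in \<open>intro integrable_divide_zero ebs\<close>)+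
  then have "(1 - \<beta>bar) * ((\<integral>\<omega>. (p \<omega>)\<^sup>2 \<partial>M) / b) \<le> (1 - \<beta>) * (\<integral>\<omega>. q \<omega> * p \<omega> \<partial>M)"
    using \<beta> b by (intro mult_mono) auto
  then have gain: "c * (\<integral>\<omega>. (p \<omega>)\<^sup>2 \<partial>M) \<le> (1 - \<beta>) * (\<integral>\<omega>. q \<omega> * p \<omega> \<partial>M)"
    by (simp add: c_def)
  have "(\<integral>\<omega>. (q \<omega> * s \<omega>) * U \<omega> \<partial>M)
      \<le> (\<integral>\<omega>. p \<omega> * s \<omega> + (c / 2 * (p \<omega>)\<^sup>2 + (S / a)\<^sup>2 / (2 * c) * (U \<omega> - W \<omega>)\<^sup>2) \<partial>M)"
  proof (rule integral_mono_AE)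
    show "AE \<omega> in M. (q \<omega> * s \<omega>) * U \<omega>
        \<le> p \<omega> * s \<omega> + (c / 2 * (p \<omega>)\<^sup>2 + (S / a)\<^sup>2 / (2 * c) * (U \<omega> - W \<omega>)\<^sup>2)"
      using W_bounds s(2)
    proof eventually_elim
      case (elim \<omega>)
      define N where "N = \<bar>U \<omega> - W \<omega>\<bar>"
      have W0: "0 < W \<omega>" using elim a_pos by linarith
      have "(q \<omega> * s \<omega>) * U \<omega> - p \<omega> * s \<omega> = (p \<omega>) * (s \<omega> / W \<omega>) * (U \<omega> - W \<omega>)"
        using W0 by (simp add: q_def field_simps)
      also have "\<dots> \<le> \<bar>p \<omega>\<bar> * (\<bar>s \<omega>\<bar> / W \<omega>) * N"
        using W0 by (metis N_def abs_ge_self abs_mult abs_divide abs_of_pos)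
      also have "\<dots> \<le> \<bar>p \<omega>\<bar> * (S / a) * N"
        using elim a_pos W0 by (intro mult_right_mono mult_left_mono frac_le) (auto simp: N_def)
      \<comment> \<open>Young's inequality, weighted so that the \<open>p\<close> part costs exactly
        half of the gain \<open>c\<close>.\<close>
      also have "\<dots> \<le> c / 2 * (p \<omega>)\<^sup>2 + (S / a)\<^sup>2 / (2 * c) * N\<^sup>2"
      proof -
        have "0 \<le> (c * \<bar>p \<omega>\<bar> - (S / a) * N)\<^sup>2 / (2 * c)"
          using c by simp
        also have "\<dots> = c / 2 * (p \<omega>)\<^sup>2 + (S / a)\<^sup>2 / (2 * c) * N\<^sup>2 - \<bar>p \<omega>\<bar> * (S / a) * N"
        proof -
          have "(c * P - T * N)\<^sup>2 / (2 * c) = c / 2 * P\<^sup>2 + T\<^sup>2 / (2 * c) * N\<^sup>2 - P * T * N" for P T :: real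
            using c by (simp add: power2_eq_square field_simps)
          from this[of "\<bar>p \<omega>\<bar>" "S / a"] show ?thesis by simp
        qed
        finally show ?thesis by simp
      qed
      finally show ?case by (simp add: N_def)
    qed
  qed (intro ebs)+
  also have "\<dots> = (\<integral>\<omega>. p \<omega> * s \<omega> \<partial>M) + (c / 2 * (\<integral>\<omega>. (p \<omega>)\<^sup>2 \<partial>M)
      + (S / a)\<^sup>2 / (2 * c) * (\<integral>\<omega>. (U \<omega> - W \<omega>)\<^sup>2 \<partial>M))"
    by (subst Bochner_Integration.integral_add, (intro ebs)+,
        subst Bochner_Integration.integral_add, (intro ebs)+) simp
  finally show ?thesis
    using key gain by linarith
qed

end

subsection \<open>Real sequences\<close>

text \<open>Multiply by the sum of the two roots, which is at least \<open>sqrt e\<close>: the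
  offset makes the square root Lipschitz.\<close>

lemma sqrt_add_diff_bound:
  fixes e y z :: real
  assumes "0 < e" "0 \<le> y" "0 \<le> z"
  shows "\<bar>sqrt (y + e) - sqrt (z + e)\<bar> \<le> \<bar>y - z\<bar> / sqrt e"
proof -
  have "\<bar>sqrt (y + e) - sqrt (z + e)\<bar> * sqrt e
      \<le> \<bar>sqrt (y + e) - sqrt (z + e)\<bar> * (sqrt (y + e) + sqrt (z + e))"
    using assms by (intro mult_left_mono add_increasing2) auto
  also have "\<dots> = \<bar>(sqrt (y + e) - sqrt (z + e)) * (sqrt (y + e) + sqrt (z + e))\<bar>"
    using assms by (simp add: abs_mult)
  also have "(sqrt (y + e) - sqrt (z + e)) * (sqrt (y + e) + sqrt (z + e)) = y - z"
    using assms by (simp add: algebra_simps)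
  finally show ?thesis
    using assms by (simp add: field_simps)
qed

text \<open>The mean value theorem on the segment from \<open>x\<close> to \<open>y\<close>, with
  the Lipschitz bound at the intermediate point. This gives \<open>L\<close> instead of the sharp
  \<open>L / 2\<close>, which is harmless because the quadratic terms only have to be
  summable.\<close>

lemma lipschitz_gradient_descent:
  fixes f :: "'a::real_inner \<Rightarrow> real"
  assumes gradient: "\<And>y. GDERIV f y :> h y"
    and lipschitz: "\<And>y z. norm (h y - h z) \<le> L * norm (y - z)"
    and "0 \<le> L"
  shows "f y \<le> f x + h x \<bullet> (y - x) + L * (norm (y - x))\<^sup>2"
proof -
  define D where "D = y - x"
  have der: "((\<lambda>t. f (x + t *\<^sub>R D)) has_derivative (\<lambda>t. (t *\<^sub>R D) \<bullet> h (x + \<tau> *\<^sub>R D)))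
      (at \<tau> within {0..1})" for \<tau> :: real
  proof -
    have "(f has_derivative (\<lambda>z. z \<bullet> h (x + \<tau> *\<^sub>R D))) (at (x + \<tau> *\<^sub>R D))"
      using gradient[of "x + \<tau> *\<^sub>R D"] by (simp add: gderiv_def)
    moreover have "((\<lambda>t. x + t *\<^sub>R D) has_derivative (\<lambda>t. t *\<^sub>R D)) (at \<tau> within {0..1})"
      by (auto intro!: derivative_eq_intros)
    ultimately show ?thesis
      by (rule has_derivative_compose[rotated])
  qed
  obtain \<tau> :: real where \<tau>: "\<tau> \<in> {0..1}"
    and eq: "f (x + 1 *\<^sub>R D) - f (x + 0 *\<^sub>R D) = ((1 - 0) *\<^sub>R D) \<bullet> h (x + \<tau> *\<^sub>R D)"
    using mvt_very_simple[OF zero_le_one der] by blast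
  have "D \<bullet> (h (x + \<tau> *\<^sub>R D) - h x) \<le> norm D * norm (h (x + \<tau> *\<^sub>R D) - h x)"
    by (rule norm_cauchy_schwarz)
  also have "\<dots> \<le> norm D * (L * norm (x + \<tau> *\<^sub>R D - x))"
    by (intro mult_left_mono lipschitz) auto
  also have "\<dots> \<le> norm D * (L * norm D)"
    using \<tau> \<open>0 \<le> L\<close> by (intro mult_left_mono) (auto intro: mult_left_le_one_le)
  finally show ?thesis
    using eq by (simp add: D_def inner_diff_right inner_commute power2_eq_square algebra_simps)
qed

text \<open>Abel summation: \<open>w n * (A - z n)\<close> is a potential that falls by at least the
  weighted increment in each step, so the sum stays under control even if \<open>z\<close>
  oscillates.\<close>

lemma sum_weighted_increments_le:
  fixes w z :: "nat \<Rightarrow> real"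
  assumes w: "\<And>n. w (Suc n) \<le> w n" and z: "\<And>n. z n \<le> A"
  shows "(\<Sum>n<N. w n * (z (Suc n) - z n)) \<le> w 0 * (A - z 0) - w N * (A - z N)"
proof (induction N)
  case (Suc N)
  have "w (Suc N) * (A - z (Suc N)) \<le> w N * (A - z (Suc N))"
    using w z by (intro mult_right_mono) auto
  with Suc show ?case by (simp add: algebra_simps)
qed simp

text \<open>
  The auxiliary sequence \<open>b\<close> absorbs the accumulated errors, so that \<open>d + b\<close> stays nonnegative and
  each gain \<open>c * q n\<close> is dominated by a single term, however the momentum weights vary.
\<close>

lemma momentum_sum_bound:
  fixes w d q r \<beta> :: "nat \<Rightarrow> real"
  assumes w: "\<And>n. w (Suc n) \<le> w n" "\<And>n. 0 \<le> w n"
    and \<beta>: "\<And>n. 0 \<le> \<beta> n" "\<And>n. \<beta> n \<le> \<beta>bar" "\<beta>bar < 1"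
    and nonneg: "0 \<le> d 0" "\<And>n. 0 \<le> c * q n" "\<And>n. 0 \<le> r n"
    and recursion: "\<And>n. \<beta> n * d n + c * q n - r n \<le> d (Suc n)"
  shows "(\<Sum>n<N. w n * (c * q n))
    \<le> (\<Sum>n<N. w n * d (Suc n)) + (\<Sum>n<N. w n * r n) / (1 - \<beta>bar)"
proof -
  define b where "b = rec_nat 0 (\<lambda>n y. \<beta>bar * y + r n)"
  have b_Suc: "b (Suc n) = \<beta>bar * b n + r n" and b_0: "b 0 = 0" for n
    by (simp_all add: b_def)
  have \<beta>bar: "0 \<le> \<beta>bar" using \<beta>(1)[of 0] \<beta>(2)[of 0] by linarith
  have b_nonneg: "0 \<le> b n" for n
    by (induction n) (use \<beta>bar nonneg in \<open>auto simp: b_Suc b_0\<close>)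
  \<comment> \<open>\<open>b\<close> decays at the slowest admissible rate
    \<open>\<beta>bar\<close>; as it is nonnegative, this dominates the decay with the actual weight
    \<open>\<beta> n\<close> and leaves room for \<open>r n\<close>.\<close>
  have step: "\<beta> n * (d n + b n) + c * q n \<le> d (Suc n) + b (Suc n)" for n
    using recursion[of n] mult_right_mono[OF \<beta>(2) b_nonneg, of n n]
    by (simp add: b_Suc algebra_simps)
  have db: "0 \<le> d n + b n" for n
  proof (induction n)
    case (Suc n)
    show ?case
      using step[of n] nonneg(2)[of n] mult_nonneg_nonneg[OF \<beta>(1) Suc, of n] by linarith
  qed (use nonneg b_0 in simp)
  have gain: "c * q n \<le> d (Suc n) + b (Suc n)" for n
    using step[of n] mult_nonneg_nonneg[OF \<beta>(1) db, of n n] by linarith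
  \<comment> \<open>The boundary term lets the induction close: of \<open>w N * b (Suc N)\<close>
    the share \<open>\<beta>bar\<close> is carried over to the next index, where the weight is no
    larger.\<close>
  have "(1 - \<beta>bar) * (\<Sum>n<N. w n * b (Suc n)) + \<beta>bar * (w N * b N) \<le> (\<Sum>n<N. w n * r n)"
  proof (induction N)
    case (Suc N)
    have "\<beta>bar * (w (Suc N) * b (Suc N)) \<le> \<beta>bar * (w N * b (Suc N))"
      using w b_nonneg \<beta>bar by (intro mult_left_mono mult_right_mono) auto
    moreover have "w N * b (Suc N) = \<beta>bar * (w N * b N) + w N * r N"
      by (simp add: b_Suc algebra_simps)
    ultimately show ?case using Suc by (simp add: algebra_simps)
  qed (simp add: b_0)
  moreover have "0 \<le> \<beta>bar * (w N * b N)"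
    using \<beta>bar w b_nonneg by simp
  ultimately have "(\<Sum>n<N. w n * b (Suc n)) \<le> (\<Sum>n<N. w n * r n) / (1 - \<beta>bar)"
    using \<beta>(3) by (simp add: field_simps)
  moreover have "(\<Sum>n<N. w n * (c * q n)) \<le> (\<Sum>n<N. w n * (d (Suc n) + b (Suc n)))"
    using gain w by (intro sum_mono mult_left_mono) auto
  moreover have "(\<Sum>n<N. w n * (d (Suc n) + b (Suc n)))
      = (\<Sum>n<N. w n * d (Suc n)) + (\<Sum>n<N. w n * b (Suc n))"
    by (simp add: distrib_left sum.distrib)
  ultimately show ?thesis by linarith
qed

text \<open>Every denominator of the ratio series contains the summand \<open>\<eta> 1\<close>, so
  bounded partial sums of \<open>\<eta>\<close> would bound the ratio series as well.\<close>

lemma partial_sums_at_top: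
  fixes \<eta> :: "nat \<Rightarrow> real"
  assumes pos: "\<And>k. 1 \<le> k \<Longrightarrow> 0 < \<eta> k"
    and ratio: "filterlim (\<lambda>N. \<Sum>k=2..N. \<eta> k / (\<Sum>i=1..k-1. \<eta> i)) at_top sequentially"
  shows "filterlim (\<lambda>K. \<Sum>k=1..K. \<eta> k) at_top sequentially"
proof -
  define S where "S K = (\<Sum>k=1..K. \<eta> k)" for K
  have mono: "S j \<le> S k" if "j \<le> k" for j k
    unfolding S_def using that pos by (intro sum_mono2) (auto intro: less_imp_le)
  have "\<exists>K. Z < S K" for Z
  proof (rule ccontr)
    assume "\<nexists>K. Z < S K"
    then have bound: "S K \<le> Z" for K by (meson not_less)
    have "(\<Sum>k=2..N. \<eta> k / (\<Sum>i=1..k-1. \<eta> i)) \<le> Z / \<eta> 1" for N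
    proof -
      have "(\<Sum>k=2..N. \<eta> k / (\<Sum>i=1..k-1. \<eta> i)) \<le> (\<Sum>k=2..N. \<eta> k / \<eta> 1)"
      proof (rule sum_mono)
        fix k assume "k \<in> {2..N}"
        then have "1 \<le> k - 1" by auto
        then have "\<eta> 1 \<le> S (k - 1)" using mono[of 1 "k - 1"] by (simp add: S_def)
        then show "\<eta> k / (\<Sum>i=1..k-1. \<eta> i) \<le> \<eta> k / \<eta> 1"
          using pos[of 1] pos[of k] \<open>k \<in> {2..N}\<close> unfolding S_def
          by (intro divide_left_mono) (auto intro!: mult_pos_pos)
      qed
      also have "\<dots> = (\<Sum>k=2..N. \<eta> k) / \<eta> 1" by (simp add: sum_divide_distrib)
      also have "\<dots> \<le> S N / \<eta> 1"
        unfolding S_def using pos[of 1] pos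
        by (intro divide_right_mono sum_mono2) (auto intro: less_imp_le)
      also have "\<dots> \<le> Z / \<eta> 1"
        using bound pos[of 1] by (intro divide_right_mono) auto
      finally show ?thesis .
    qed
    moreover have "\<forall>\<^sub>F N in sequentially. Z / \<eta> 1 < (\<Sum>k=2..N. \<eta> k / (\<Sum>i=1..k-1. \<eta> i))"
      using ratio by (simp add: filterlim_at_top_dense)
    ultimately show False
      by (meson eventually_happens leD sequentially_bot)
  qed
  then have "\<forall>\<^sub>F K in sequentially. Z < S K" for Z
    unfolding eventually_sequentially by (meson mono less_le_trans)
  then show ?thesis
    unfolding filterlim_at_top_dense S_def by blast
qed

text \<open>The minimum is at most every \<open>y k\<close>, so its product with the total weight
  between \<open>J\<close> and \<open>K\<close> is bounded by a small tail of the convergent series.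
  By divergence this weight is at least half of the full sum for large \<open>K\<close>.\<close>

lemma running_Min_smallo:
  fixes \<eta> y :: "nat \<Rightarrow> real"
  assumes pos: "\<And>k. 1 \<le> k \<Longrightarrow> 0 < \<eta> k" and nonneg: "\<And>k. 0 \<le> y k"
    and summable: "summable (\<lambda>n. \<eta> (Suc n) * y (Suc n))"
    and diverges: "filterlim (\<lambda>K. \<Sum>k=1..K. \<eta> k) at_top sequentially"
  shows "(\<lambda>K. Min (y ` {1..K})) \<in> o[sequentially](\<lambda>K. 1 / (\<Sum>k=1..K. \<eta> k))"
proof (rule smalloI_tendsto)
  define S where "S K = (\<Sum>k=1..K. \<eta> k)" for K
  have S_pos: "0 < S K" if "1 \<le> K" for K
    unfolding S_def using that pos by (intro sum_pos) auto
  show "\<forall>\<^sub>F K in sequentially. 1 / (\<Sum>k=1..K. \<eta> k) \<noteq> 0"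
    using eventually_ge_at_top[of 1] by eventually_elim (use S_pos in \<open>force simp: S_def\<close>)
  have "(\<lambda>K. Min (y ` {1..K}) * S K) \<longlonglongrightarrow> 0"
  proof (rule tendstoI)
    fix e :: real assume "0 < e"
    then obtain J where J: "\<And>K. norm (\<Sum>n\<in>{J..<K}. \<eta> (Suc n) * y (Suc n)) < e / 2"
      using summable[unfolded summable_Cauchy, rule_format, of "e / 2"] by auto
    have "\<forall>\<^sub>F K in sequentially. 2 * S J \<le> S K"
      using diverges by (simp add: filterlim_at_top S_def)
    then show "\<forall>\<^sub>F K in sequentially. dist (Min (y ` {1..K}) * S K) 0 < e"
      using eventually_ge_at_top[of "Suc J"]
    proof eventually_elim
      case (elim K)
      define A where "A = Min (y ` {1..K})"
      have A_le: "A \<le> y k" if "k \<in> {1..K}" for k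
        unfolding A_def using that by (intro Min_le) auto
      have "A \<in> y ` {1..K}"
        unfolding A_def using elim by (intro Min_in) auto
      then have A_nonneg: "0 \<le> A" using nonneg by auto
      have "S K = S J + (\<Sum>n\<in>{J..<K}. \<eta> (Suc n))"
        using elim sum.atLeastLessThan_concat[of 0 J K "\<lambda>n. \<eta> (Suc n)"]
        by (simp add: S_def sum.atLeast1_atMost_eq lessThan_atLeast0)
      then have "A * (S K - S J) = (\<Sum>n\<in>{J..<K}. \<eta> (Suc n) * A)"
        by (simp add: sum_distrib_left mult.commute)
      also have "\<dots> \<le> (\<Sum>n\<in>{J..<K}. \<eta> (Suc n) * y (Suc n))"
        using A_le pos by (intro sum_mono mult_left_mono) (auto intro: less_imp_le)
      also have "\<dots> < e / 2" using J[of K] by simp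
      finally have "A * (S K - S J) < e / 2" .
      moreover have "A * S K \<le> A * (2 * (S K - S J))"
        using elim A_nonneg by (intro mult_left_mono) auto
      moreover have "0 \<le> A * S K"
        using A_nonneg S_pos[of K] elim by simp
      ultimately have "\<bar>A * S K\<bar> < e"
        by (simp add: algebra_simps)
      then show ?case
        by (simp add: A_def)
    qed
  qed
  then show "(\<lambda>K. Min (y ` {1..K}) / (1 / (\<Sum>k=1..K. \<eta> k))) \<longlonglongrightarrow> 0"
    by (simp add: S_def)
qed

subsection \<open>Measurability\<close>

lemma space_past_sigma: "space (past_sigma M x k) = space M"
  by (simp add: past_sigma_def space_measure_of_conv)

lemma sets_past_sigma:
  "sets (past_sigma M x k)
    = sigma_sets (space M) (\<Union>i\<in>{1..k}. {x i -` A \<inter> space M | A. A \<in> sets borel})"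
  unfolding past_sigma_def by (intro sets_measure_of) auto

lemma subalgebra_past_sigma:
  assumes "\<And>i. 1 \<le> i \<Longrightarrow> i \<le> k \<Longrightarrow> x i \<in> borel_measurable M"
  shows "subalgebra M (past_sigma M x k)"
proof -
  have "(\<Union>i\<in>{1..k}. {x i -` A \<inter> space M | A. A \<in> sets borel}) \<subseteq> sets M"
    using measurable_sets[OF assms] by fastforce
  then have "sets (past_sigma M x k) \<subseteq> sets M"
    unfolding sets_past_sigma by (rule sets.sigma_sets_subset)
  then show ?thesis
    by (simp add: subalgebra_def space_past_sigma)
qed

lemma past_sigma_mono:
  assumes "j \<le> k"
  shows "subalgebra (past_sigma M x k) (past_sigma M x j)"
proof -
  have "sets (past_sigma M x j) \<subseteq> sets (past_sigma M x k)"
    unfolding sets_past_sigma using assms by (intro sigma_sets_mono') force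
  then show ?thesis
    by (simp add: subalgebra_def space_past_sigma)
qed

lemma measurable_past_sigma:
  fixes x :: "nat \<Rightarrow> 'w \<Rightarrow> 'b::topological_space"
  assumes "1 \<le> i" and "i \<le> k"
  shows "x i \<in> borel_measurable (past_sigma M x k)"
proof (rule measurableI)
  fix A :: "'b set" assume "A \<in> sets borel"
  then have "x i -` A \<inter> space M \<in> (\<Union>i\<in>{1..k}. {x i -` A \<inter> space M | A. A \<in> sets borel})"
    using assms by (intro UN_I[of i]) auto
  then show "x i -` A \<inter> space (past_sigma M x k) \<in> sets (past_sigma M x k)"
    unfolding space_past_sigma sets_past_sigma by (rule sigma_sets.Basic)
qed simp

lemma vec_nth_borel_measurable [measurable]:
  "(\<lambda>y::real ^ 'd. y $ i) \<in> borel_measurable borel"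
  by (intro borel_measurable_continuous_onI continuous_intros)

lemma vec_borel_measurableI:
  fixes X :: "'w \<Rightarrow> real ^ 'd"
  assumes "\<And>i. (\<lambda>\<omega>. X \<omega> $ i) \<in> borel_measurable M"
  shows "X \<in> borel_measurable M"
  using assms by (subst borel_measurable_euclidean_space) (auto simp: Basis_vec_def inner_axis)

text \<open>The recursions of \<open>adam\<close> hold only on \<open>space M\<close>; measurability
  is carried over from their right-hand sides by agreement there.\<close>

lemma borel_measurable_eq_on_space:
  assumes "Y \<in> borel_measurable M" and "\<And>\<omega>. \<omega> \<in> space M \<Longrightarrow> X \<omega> = Y \<omega>"
  shows "X \<in> borel_measurable M"
  using assms measurable_cong[of M X Y borel] by simp

subsection \<open>The iterates\<close>

locale bounded_adam = adam M P loss f \<xi> \<eta> \<epsilon> \<beta> \<beta>bar \<theta> x1 g m v x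
  for M :: "'w measure" and P :: "'s measure"
    and loss :: "real ^ 'd \<Rightarrow> 's \<Rightarrow> real"
    and f :: "real ^ 'd \<Rightarrow> real"
    and \<xi> :: "nat \<Rightarrow> 'w \<Rightarrow> 's"
    and \<eta> :: "nat \<Rightarrow> real" and \<epsilon> :: real
    and \<beta> :: "nat \<Rightarrow> real" and \<beta>bar :: real
    and \<theta> :: "nat \<Rightarrow> real"
    and x1 :: "real ^ 'd"
    and g m v x :: "nat \<Rightarrow> 'w \<Rightarrow> real ^ 'd" +
  fixes grad_f :: "real ^ 'd \<Rightarrow> real ^ 'd" and G L :: real
  assumes gradient: "\<And>y. GDERIV f y :> grad_f y"
    and unbiased: "\<And>k. 1 \<le> k \<Longrightarrow>
          AE \<omega> in M. vec_cond_exp M (past_sigma M x k) (g k) \<omega> = grad_f (x k \<omega>)"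
    and G_pos: "0 < G"
    and bounded: "\<And>k. 1 \<le> k \<Longrightarrow> AE \<omega> in M. norm (g k \<omega>) \<le> G"
    and bounded_below: "bdd_below (range f)"
    and L_pos: "0 < L"
    and smooth: "\<And>y z. norm (grad_f y - grad_f z) \<le> L * norm (y - z)"
    and decreasing: "\<And>k. 1 \<le> k \<Longrightarrow> \<eta> (k + 1) \<le> \<eta> k"
    and squares_summable: "summable (\<lambda>k. (\<eta> (k + 1))\<^sup>2)"
    and theta_summable: "summable (\<lambda>k. \<eta> (k + 1) * (1 - \<theta> (k + 1)))"
begin

definition u :: "nat \<Rightarrow> 'd \<Rightarrow> 'w \<Rightarrow> real"
  where "u k i \<omega> = sqrt (v k \<omega> $ i + \<epsilon>)"

definition s :: "nat \<Rightarrow> 'd \<Rightarrow> 'w \<Rightarrow> real"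
  where "s k i \<omega> = m k \<omega> $ i / u k i \<omega>"

definition p :: "nat \<Rightarrow> 'd \<Rightarrow> 'w \<Rightarrow> real"
  where "p k i \<omega> = grad_f (x k \<omega>) $ i"

text \<open>
  The root of the second moment averaged over the available information: \<open>v k\<close> need not be
  measurable with respect to \<open>x 1, \<dots>, x (k + 1)\<close>, because a step does not determine the stochastic
  gradient that caused it.
\<close>

definition U :: "nat \<Rightarrow> 'd \<Rightarrow> 'w \<Rightarrow> real"
  where "U k i = real_cond_exp M (past_sigma M x (Suc k)) (u k i)"

text \<open>On regular paths \<open>a\<close> and \<open>b\<close> enclose every
  \<open>u k i\<close>, and \<open>S\<close> bounds the normalised steps.\<close>

definition a :: real where "a = sqrt \<epsilon>"
definition b :: real where "b = sqrt (G\<^sup>2 + \<epsilon>)"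
definition S :: real where "S = G / a"

text \<open>Collects the countably many null sets of the gradient bounds once, so that the estimates
  on the iterates can be proved path by path.\<close>

definition regular :: "'w \<Rightarrow> bool"
  where "regular \<omega> \<longleftrightarrow> \<omega> \<in> space M \<and> (\<forall>k\<ge>1. norm (g k \<omega>) \<le> G)"

lemma AE_regular: "AE \<omega> in M. regular \<omega>"
proof -
  have "AE \<omega> in M. \<forall>k. 1 \<le> k \<longrightarrow> norm (g k \<omega>) \<le> G"
    unfolding AE_all_countable using bounded by auto
  then show ?thesis
    unfolding regular_def by auto
qed

lemma regular_AE_I: "(\<And>\<omega>. regular \<omega> \<Longrightarrow> Q \<omega>) \<Longrightarrow> AE \<omega> in M. Q \<omega>"
  using AE_regular by (auto elim: eventually_mono)

section \<open>Bounds on the iterates along regular paths\<close>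

lemma a_pos: "0 < a"
  by (simp add: a_def eps_pos)

lemma b_pos: "0 < b"
  unfolding b_def using eps_pos by (simp add: add_nonneg_pos)

lemma S_nonneg: "0 \<le> S"
  unfolding S_def using G_pos a_pos by simp

lemma beta_facts:
  assumes "1 \<le> k" shows "0 \<le> \<beta> k" "\<beta> k < 1" "\<beta> k \<le> \<beta>bar"
  using beta_range[OF assms] beta_bar by auto

lemma grad_component_bound:
  assumes "regular \<omega>" "1 \<le> k"
  shows "\<bar>g k \<omega> $ i\<bar> \<le> G"
  using assms component_le_norm_cart[of "g k \<omega>" i] by (force simp: regular_def)

lemma v_step:
  assumes "\<omega> \<in> space M"
  shows "v (Suc k) \<omega> $ i = \<theta> (Suc k) * v k \<omega> $ i + (1 - \<theta> (Suc k)) * (g (Suc k) \<omega> $ i)\<^sup>2"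
  using step_v[of "Suc k", OF _ assms] by simp

lemma m_step:
  assumes "\<omega> \<in> space M"
  shows "m (Suc k) \<omega> $ i = \<beta> (Suc k) * m k \<omega> $ i + (1 - \<beta> (Suc k)) * g (Suc k) \<omega> $ i"
  using step_m[of "Suc k", OF _ assms] by simp

lemma x_step:
  assumes "\<omega> \<in> space M" "1 \<le> k"
  shows "x (Suc k) \<omega> $ i = x k \<omega> $ i - \<eta> k * s k i \<omega>"
  using step_x[OF assms(2,1)] by (simp add: s_def u_def)

lemma grad_square_bound:
  assumes "regular \<omega>"
  shows "(g (Suc k) \<omega> $ i)\<^sup>2 \<le> G\<^sup>2"
  using power_mono[OF grad_component_bound[OF assms, of "Suc k" i], of 2] by simp

lemma v_bounds:
  assumes "regular \<omega>"
  shows "0 \<le> v k \<omega> $ i \<and> v k \<omega> $ i \<le> G\<^sup>2"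
proof (induction k)
  case 0
  then show ?case using assms by (simp add: regular_def init_v)
next
  case (Suc k)
  have \<theta>: "0 < \<theta> (Suc k)" "\<theta> (Suc k) < 1"
    using theta_range[of "Suc k"] by auto
  have "v (Suc k) \<omega> $ i \<le> \<theta> (Suc k) * G\<^sup>2 + (1 - \<theta> (Suc k)) * G\<^sup>2"
    unfolding v_step[OF conjunct1[OF assms[unfolded regular_def]]]
    using Suc \<theta> grad_square_bound[OF assms]
    by (intro add_mono mult_left_mono) auto
  moreover have "0 \<le> v (Suc k) \<omega> $ i"
    unfolding v_step[OF conjunct1[OF assms[unfolded regular_def]]] using Suc \<theta> by simp
  ultimately show ?case by (simp add: algebra_simps)
qed

lemma m_bound:
  assumes "regular \<omega>"
  shows "\<bar>m k \<omega> $ i\<bar> \<le> G"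
proof (induction k)
  case 0
  then show ?case using assms G_pos by (simp add: regular_def init_m)
next
  case (Suc k)
  have \<beta>: "0 \<le> \<beta> (Suc k)" "\<beta> (Suc k) < 1"
    using beta_facts[of "Suc k"] by auto
  have "\<bar>m (Suc k) \<omega> $ i\<bar> \<le> \<beta> (Suc k) * \<bar>m k \<omega> $ i\<bar> + (1 - \<beta> (Suc k)) * \<bar>g (Suc k) \<omega> $ i\<bar>"
    using assms \<beta> abs_triangle_ineq[of "\<beta> (Suc k) * m k \<omega> $ i" "(1 - \<beta> (Suc k)) * g (Suc k) \<omega> $ i"]
    by (simp add: regular_def m_step abs_mult)
  also have "\<dots> \<le> \<beta> (Suc k) * G + (1 - \<beta> (Suc k)) * G"
    using Suc \<beta> grad_component_bound[OF assms] by (intro add_mono mult_left_mono) auto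
  finally show ?case by (simp add: algebra_simps)
qed

lemma u_bounds:
  assumes "regular \<omega>"
  shows "a \<le> u k i \<omega> \<and> u k i \<omega> \<le> b"
  using v_bounds[OF assms] by (simp add: u_def a_def b_def)

lemma s_bound:
  assumes "regular \<omega>"
  shows "\<bar>s k i \<omega>\<bar> \<le> S"
  unfolding s_def S_def abs_divide
  using m_bound[OF assms] u_bounds[OF assms, of k i] a_pos G_pos by (intro frac_le) auto

text \<open>The second moment moves by \<open>1 - \<theta> (Suc k)\<close> times the difference of
  two numbers in \<open>[0, G\<^sup>2]\<close>. This is the error \<open>e\<close> of
  \<open>increment_second_moment\<close>, made summable by the hypothesis on
  \<open>\<eta> k * (1 - \<theta> k)\<close>.\<close>

lemma u_increment:
  assumes "regular \<omega>"
  shows "\<bar>u (Suc k) i \<omega> - u k i \<omega>\<bar> \<le> (1 - \<theta> (Suc k)) * (G\<^sup>2 / a)"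
proof -
  have \<theta>: "\<theta> (Suc k) < 1" using theta_range[of "Suc k"] by auto
  have "v (Suc k) \<omega> $ i - v k \<omega> $ i = (1 - \<theta> (Suc k)) * ((g (Suc k) \<omega> $ i)\<^sup>2 - v k \<omega> $ i)"
    using assms by (simp add: v_step regular_def algebra_simps)
  moreover have "\<bar>(g (Suc k) \<omega> $ i)\<^sup>2 - v k \<omega> $ i\<bar> \<le> G\<^sup>2"
    using grad_square_bound[OF assms, of k i] v_bounds[OF assms, of k i]
    by (smt (verit) zero_le_power2)
  ultimately have "\<bar>v (Suc k) \<omega> $ i - v k \<omega> $ i\<bar> \<le> (1 - \<theta> (Suc k)) * G\<^sup>2"
    using \<theta> by (simp add: abs_mult mult_left_mono)
  then have "\<bar>v (Suc k) \<omega> $ i - v k \<omega> $ i\<bar> / a \<le> (1 - \<theta> (Suc k)) * G\<^sup>2 / a"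
    using a_pos by (intro divide_right_mono) auto
  then show ?thesis
    unfolding u_def
    using sqrt_add_diff_bound[OF eps_pos, of "v (Suc k) \<omega> $ i" "v k \<omega> $ i"] v_bounds[OF assms]
    by (simp add: a_def)
qed

text \<open>The norm is bounded by the sum of the coordinates, whence the dimension factor; only the
  order \<open>\<eta> k\<close> matters later.\<close>

lemma step_norm:
  assumes "regular \<omega>" "1 \<le> k"
  shows "norm (x (Suc k) \<omega> - x k \<omega>) \<le> \<eta> k * (real CARD('d) * S)"
proof -
  have "norm (x (Suc k) \<omega> - x k \<omega>) \<le> (\<Sum>i\<in>UNIV. \<bar>(x (Suc k) \<omega> - x k \<omega>) $ i\<bar>)"
    by (rule norm_le_l1_cart)
  also have "\<dots> \<le> (\<Sum>i\<in>(UNIV::'d set). \<eta> k * S)"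
  proof (rule sum_mono)
    fix i
    have "\<bar>(x (Suc k) \<omega> - x k \<omega>) $ i\<bar> = \<eta> k * \<bar>s k i \<omega>\<bar>"
      using assms step_size_pos[OF assms(2)] by (simp add: x_step regular_def abs_mult)
    also have "\<dots> \<le> \<eta> k * S"
      using s_bound[OF assms(1)] step_size_pos[OF assms(2)] by (intro mult_left_mono) auto
    finally show "\<bar>(x (Suc k) \<omega> - x k \<omega>) $ i\<bar> \<le> \<eta> k * S" .
  qed
  finally show ?thesis by (simp add: mult_ac)
qed

lemma recursion:
  assumes "\<omega> \<in> space M" "regular \<omega>"
  shows "u (Suc k) i \<omega> * s (Suc k) i \<omega>
    = \<beta> (Suc k) * (u k i \<omega> * s k i \<omega>) + (1 - \<beta> (Suc k)) * g (Suc k) \<omega> $ i"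
proof -
  have "u k i \<omega> * s k i \<omega> = m k \<omega> $ i" for k
    using u_bounds[OF assms(2), of k i] a_pos by (simp add: s_def)
  then show ?thesis using assms by (simp add: m_step)
qed

subsection \<open>Expectations along the trajectory\<close>

lemma grad_component_measurable:
  assumes "1 \<le> k" shows "(\<lambda>\<omega>. g k \<omega> $ i) \<in> borel_measurable M"
  using measurable_compose[OF grad_measurable[OF assms] vec_nth_borel_measurable] .

lemma v_measurable: "(\<lambda>\<omega>. v k \<omega> $ i) \<in> borel_measurable M"
proof (induction k)
  case 0
  show ?case
    by (rule borel_measurable_eq_on_space[of "\<lambda>_. 0"]) (auto simp: init_v)
next
  case (Suc k)
  show ?case
    by (rule borel_measurable_eq_on_space[OF _ v_step])
      (intro borel_measurable_add borel_measurable_times borel_measurable_const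
        borel_measurable_power Suc grad_component_measurable, simp_all)
qed

lemma m_measurable: "(\<lambda>\<omega>. m k \<omega> $ i) \<in> borel_measurable M"
proof (induction k)
  case 0
  show ?case
    by (rule borel_measurable_eq_on_space[of "\<lambda>_. 0"]) (auto simp: init_m)
next
  case (Suc k)
  show ?case
    by (rule borel_measurable_eq_on_space[OF _ m_step])
      (intro borel_measurable_add borel_measurable_times borel_measurable_const Suc
        grad_component_measurable, simp_all)
qed

lemma u_measurable: "u k i \<in> borel_measurable M"
  unfolding u_def using v_measurable[of k i] by simp

lemma x_measurable:
  assumes "1 \<le> k" shows "x k \<in> borel_measurable M"
  using assms
proof (induction k rule: nat_induct_at_least)
  case base
  show ?case
    by (rule borel_measurable_eq_on_space[of "\<lambda>_. x1"]) (use init_x in auto)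
next
  case (Suc k)
  show ?case
  proof (rule vec_borel_measurableI)
    fix i
    show "(\<lambda>\<omega>. x (Suc k) \<omega> $ i) \<in> borel_measurable M"
    proof (rule borel_measurable_eq_on_space[OF _ x_step[OF _ Suc.hyps]])
      show "(\<lambda>\<omega>. x k \<omega> $ i - \<eta> k * s k i \<omega>) \<in> borel_measurable M"
        unfolding s_def
        by (intro borel_measurable_diff borel_measurable_times borel_measurable_const
            borel_measurable_divide u_measurable m_measurable
            measurable_compose[OF Suc.IH vec_nth_borel_measurable])
    qed
  qed
qed

lemma subalgebra_past: "subalgebra M (past_sigma M x k)"
  by (intro subalgebra_past_sigma x_measurable)

lemma s_measurable: "s k i \<in> borel_measurable (past_sigma M x (Suc k))"
proof (cases "k = 0")
  case True
  show ?thesis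
    by (rule borel_measurable_eq_on_space[of "\<lambda>_. 0"])
      (use True in \<open>auto simp: s_def init_m space_past_sigma\<close>)
next
  case False
  then have k: "1 \<le> k" by simp
  have "(\<lambda>\<omega>. x j \<omega> $ i) \<in> borel_measurable (past_sigma M x (Suc k))" if "1 \<le> j" "j \<le> Suc k" for j
    by (rule measurable_compose[OF measurable_past_sigma[OF that] vec_nth_borel_measurable])
  then have "(\<lambda>\<omega>. (x k \<omega> $ i - x (Suc k) \<omega> $ i) / \<eta> k) \<in> borel_measurable (past_sigma M x (Suc k))"
    using k by (intro borel_measurable_divide borel_measurable_diff borel_measurable_const) auto
  then show ?thesis
  proof (rule borel_measurable_eq_on_space)
    fix \<omega> assume "\<omega> \<in> space (past_sigma M x (Suc k))"
    then show "s k i \<omega> = (x k \<omega> $ i - x (Suc k) \<omega> $ i) / \<eta> k"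
      using x_step[OF _ k, of \<omega> i] step_size_pos[OF k] by (simp add: space_past_sigma)
  qed
qed

lemma grad_f_measurable: "grad_f \<in> borel_measurable borel"
proof (rule borel_measurable_continuous_onI)
  have "lipschitz_on L UNIV grad_f"
    using smooth L_pos by (intro lipschitz_onI) (auto simp: dist_norm)
  then show "continuous_on UNIV grad_f"
    by (rule lipschitz_on_continuous_on)
qed

lemma p_measurable:
  assumes "1 \<le> k" shows "p k i \<in> borel_measurable (past_sigma M x k)"
  unfolding p_def
  using measurable_compose[OF measurable_compose[OF measurable_past_sigma[OF assms order_refl]
    grad_f_measurable] vec_nth_borel_measurable] .

lemma cond_exp_grad:
  assumes "1 \<le> k"
  shows "AE \<omega> in M. real_cond_exp M (past_sigma M x k) (\<lambda>\<omega>. g k \<omega> $ i) \<omega> = p k i \<omega>"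
  using unbiased[OF assms] by eventually_elim (auto simp: vec_cond_exp_def p_def vec_eq_iff)

text \<open>The true gradient along the trajectory inherits the bound of the stochastic gradient,
  being its conditional mean.\<close>

lemma p_bound:
  assumes "1 \<le> k"
  shows "AE \<omega> in M. \<bar>p k i \<omega>\<bar> \<le> G"
proof -
  have "- G \<le> g k \<omega> $ i \<and> g k \<omega> $ i \<le> G" if "regular \<omega>" for \<omega>
    using grad_component_bound[OF that assms, of i] by linarith
  then have "AE \<omega> in M. - G \<le> g k \<omega> $ i \<and> g k \<omega> $ i \<le> G"
    by (rule regular_AE_I)
  note M.cond_exp_bounds[OF subalgebra_past grad_component_measurable[OF assms] this, of k]
  then show ?thesis
    using cond_exp_grad[OF assms, of i] by eventually_elim auto
qed

lemma ess_bounded_p: "1 \<le> k \<Longrightarrow> ess_bounded M (p k i)"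
  by (rule ess_boundedI[OF measurable_from_subalg[OF subalgebra_past p_measurable] p_bound])

lemma ess_bounded_s: "ess_bounded M (s k i)"
  by (rule ess_boundedI[OF measurable_from_subalg[OF subalgebra_past s_measurable], of _ _ S])
    (auto intro!: regular_AE_I s_bound)

text \<open>The indices are such that the averages \<open>U\<close> and \<open>W\<close> of the
  locale become \<open>U (Suc n) i\<close> and \<open>U n i\<close>.\<close>

lemma preconditioner_step:
  "preconditioner_step M (past_sigma M x (Suc n)) (past_sigma M x (Suc (Suc n))) (u (Suc n) i) (u n i) a b"
  by (intro preconditioner_step.intro M.prob_space_axioms preconditioner_step_axioms.intro
      subalgebra_past past_sigma_mono u_measurable a_pos regular_AE_I u_bounds) auto

section \<open>Expected alignment of the gradient with the step\<close>

definition c :: real where "c = (1 - \<beta>bar) / b"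

definition err :: "nat \<Rightarrow> 'd \<Rightarrow> real"
  where "err n i = (\<integral>\<omega>. (U (Suc n) i \<omega> - U n i \<omega>)\<^sup>2 \<partial>M)"

text \<open>Up to the factor \<open>\<eta> k\<close>, the share of coordinate \<open>i\<close> in
  the expected first-order decrease of \<open>f\<close>.\<close>

definition align :: "nat \<Rightarrow> 'd \<Rightarrow> real"
  where "align k i = (\<integral>\<omega>. p k i \<omega> * s k i \<omega> \<partial>M)"

lemma c_pos: "0 < c"
  using beta_bar b_pos by (simp add: c_def)

lemma align_0: "align 0 i = 0"
proof -
  have "align 0 i = (\<integral>\<omega>. 0 \<partial>M)"
    unfolding align_def by (intro Bochner_Integration.integral_cong) (auto simp: s_def init_m)
  then show ?thesis by simp
qed

text \<open>The old step is paired with the new gradient; returning to the old gradient costs the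
  Lipschitz constant times the length of the step. The absolute value keeps the error nonnegative at
  \<open>n = 0\<close>, where \<open>\<eta> 0\<close> is arbitrary and both means vanish.\<close>

lemma momentum_drift:
  "align n i - L * real CARD('d) * S\<^sup>2 * \<bar>\<eta> n\<bar> \<le> (\<integral>\<omega>. p (Suc n) i \<omega> * s n i \<omega> \<partial>M)"
proof (cases "n = 0")
  case True
  have "(\<integral>\<omega>. p (Suc n) i \<omega> * s n i \<omega> \<partial>M) = (\<integral>\<omega>. 0 \<partial>M)"
    using True by (intro Bochner_Integration.integral_cong) (auto simp: s_def init_m)
  then show ?thesis
    using True L_pos by (simp add: align_0)
next
  case False
  then have n: "1 \<le> n" by simp
  have "p n i \<omega> * s n i \<omega> - p (Suc n) i \<omega> * s n i \<omega> \<le> L * real CARD('d) * S\<^sup>2 * \<bar>\<eta> n\<bar>"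
    if "regular \<omega>" for \<omega>
  proof -
    have "\<bar>p n i \<omega> - p (Suc n) i \<omega>\<bar> \<le> norm (grad_f (x (Suc n) \<omega>) - grad_f (x n \<omega>))"
      using component_le_norm_cart[of "grad_f (x (Suc n) \<omega>) - grad_f (x n \<omega>)" i]
      by (simp add: p_def abs_minus_commute)
    also have "\<dots> \<le> L * norm (x (Suc n) \<omega> - x n \<omega>)"
      by (rule smooth)
    also have "\<dots> \<le> L * (\<eta> n * (real CARD('d) * S))"
      using L_pos step_norm[OF that n] by (intro mult_left_mono) auto
    finally have "\<bar>p n i \<omega> - p (Suc n) i \<omega>\<bar> * \<bar>s n i \<omega>\<bar> \<le> L * (\<eta> n * (real CARD('d) * S)) * S"
      using s_bound[OF that, of n i] S_nonneg by (intro mult_mono') auto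
    moreover have "p n i \<omega> * s n i \<omega> - p (Suc n) i \<omega> * s n i \<omega>
        \<le> \<bar>p n i \<omega> - p (Suc n) i \<omega>\<bar> * \<bar>s n i \<omega>\<bar>"
      unfolding left_diff_distrib[symmetric] abs_mult[symmetric] by simp
    ultimately show ?thesis
      using step_size_pos[OF n] by (simp add: power2_eq_square mult_ac)
  qed
  then have "(\<integral>\<omega>. p n i \<omega> * s n i \<omega> - p (Suc n) i \<omega> * s n i \<omega> \<partial>M) \<le> L * real CARD('d) * S\<^sup>2 * \<bar>\<eta> n\<bar>"
    by (intro M.integral_le_const regular_AE_I M.ess_bounded_integrable ess_bounded_intros
        ess_bounded_p ess_bounded_s n) auto
  also have "(\<integral>\<omega>. p n i \<omega> * s n i \<omega> - p (Suc n) i \<omega> * s n i \<omega> \<partial>M)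
      = align n i - (\<integral>\<omega>. p (Suc n) i \<omega> * s n i \<omega> \<partial>M)"
    unfolding align_def
    by (intro Bochner_Integration.integral_diff M.ess_bounded_integrable ess_bounded_intros
        ess_bounded_p ess_bounded_s n) auto
  finally show ?thesis by simp
qed

text \<open>Combines \<open>expected_descent\<close> with the drift. As
  \<open>\<beta> (Suc n)\<close> is at most 1, the drift error can be kept unweighted, which gives
  the form that \<open>momentum_sum_bound\<close> expects.\<close>

lemma align_recursion:
  "\<beta> (Suc n) * align n i + c / 2 * (\<integral>\<omega>. (p (Suc n) i \<omega>)\<^sup>2 \<partial>M)
    - ((S / a)\<^sup>2 / (2 * c) * err n i + L * real CARD('d) * S\<^sup>2 * \<bar>\<eta> n\<bar>) \<le> align (Suc n) i"
proof -
  have g: "ess_bounded M (\<lambda>\<omega>. g (Suc n) \<omega> $ i)"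
    by (rule ess_boundedI[OF grad_component_measurable, of _ _ G])
      (auto intro!: regular_AE_I grad_component_bound)
  have \<beta>: "0 \<le> \<beta> (Suc n)" "\<beta> (Suc n) \<le> \<beta>bar" "\<beta> (Suc n) \<le> 1"
    using beta_facts[of "Suc n"] by auto
  have "\<beta> (Suc n) * (\<integral>\<omega>. p (Suc n) i \<omega> * s n i \<omega> \<partial>M) + c / 2 * (\<integral>\<omega>. (p (Suc n) i \<omega>)\<^sup>2 \<partial>M)
      - (S / a)\<^sup>2 / (2 * c) * err n i \<le> align (Suc n) i"
    unfolding err_def align_def U_def c_def
    by (rule preconditioner_step.expected_descent[OF preconditioner_step s_measurable regular_AE_I[OF s_bound] s_measurable
        regular_AE_I[OF s_bound] p_measurable p_bound g cond_exp_grad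
        regular_AE_I[OF recursion] \<beta>(2) beta_bar])
      (auto simp: regular_def)
  moreover have "\<beta> (Suc n) * (align n i - L * real CARD('d) * S\<^sup>2 * \<bar>\<eta> n\<bar>)
      \<le> \<beta> (Suc n) * (\<integral>\<omega>. p (Suc n) i \<omega> * s n i \<omega> \<partial>M)"
    using momentum_drift \<beta> by (intro mult_left_mono)
  moreover have "\<beta> (Suc n) * (L * real CARD('d) * S\<^sup>2 * \<bar>\<eta> n\<bar>) \<le> L * real CARD('d) * S\<^sup>2 * \<bar>\<eta> n\<bar>"
    using \<beta> L_pos by (intro mult_left_le_one_le) auto
  ultimately show ?thesis
    by (simp add: algebra_simps)
qed

section \<open>Uniform bounds on the weighted errors and alignments\<close>

lemma U_second_moment: "(\<integral>\<omega>. (U n i \<omega>)\<^sup>2 \<partial>M) \<le> b\<^sup>2"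
proof -
  have bounds: "AE \<omega> in M. a \<le> U n i \<omega> \<and> U n i \<omega> \<le> b"
    unfolding U_def
    by (intro M.cond_exp_bounds subalgebra_past u_measurable regular_AE_I u_bounds)
  have "AE \<omega> in M. (U n i \<omega>)\<^sup>2 \<le> b\<^sup>2"
    using bounds by eventually_elim (use a_pos in \<open>auto intro: power_mono\<close>)
  moreover have "ess_bounded M (U n i)"
  proof (rule ess_boundedI)
    show "U n i \<in> borel_measurable M"
      unfolding U_def by (rule borel_measurable_cond_exp2)
    show "AE \<omega> in M. \<bar>U n i \<omega>\<bar> \<le> b"
      using bounds by eventually_elim (use a_pos in auto)
  qed
  ultimately show ?thesis
    by (intro M.integral_le_const M.ess_bounded_integrable ess_bounded_square)
qed

text \<open>Each error is an increment of the bounded second moments of \<open>U\<close> plus a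
  multiple of \<open>1 - \<theta> (Suc n)\<close>. The increments are summed against decreasing
  weights, the remainder by hypothesis.\<close>

lemma weighted_err_bounded: "\<exists>B. \<forall>N. (\<Sum>n<N. \<eta> (Suc n) * err n i) \<le> B"
proof (intro exI allI)
  fix N
  define z where "z n = (\<integral>\<omega>. (U n i \<omega>)\<^sup>2 \<partial>M)" for n
  have z: "0 \<le> z n" "z n \<le> b\<^sup>2" for n
    using U_second_moment by (auto simp: z_def)
  have \<eta>: "0 < \<eta> (Suc n)" "\<eta> (Suc (Suc n)) \<le> \<eta> (Suc n)" for n
    using step_size_pos[of "Suc n"] decreasing[of "Suc n"] by auto
  have \<theta>: "\<theta> (Suc n) < 1" for n
    using theta_range[of "Suc n"] by auto
  have err: "err n i \<le> (z (Suc n) - z n) + 2 * b * ((1 - \<theta> (Suc n)) * (G\<^sup>2 / a))" for n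
    using preconditioner_step.increment_second_moment[OF preconditioner_step
      regular_AE_I[OF u_increment], of n i]
    unfolding err_def z_def U_def by simp
  have "(\<Sum>n<N. \<eta> (Suc n) * err n i)
      \<le> (\<Sum>n<N. \<eta> (Suc n) * ((z (Suc n) - z n) + 2 * b * ((1 - \<theta> (Suc n)) * (G\<^sup>2 / a))))"
    using err \<eta> by (intro sum_mono mult_left_mono) (auto intro: less_imp_le)
  also have "\<dots> = (\<Sum>n<N. \<eta> (Suc n) * (z (Suc n) - z n))
      + 2 * b * (G\<^sup>2 / a) * (\<Sum>n<N. \<eta> (Suc n) * (1 - \<theta> (Suc n)))"
    unfolding distrib_left sum.distrib sum_distrib_left
    by (intro arg_cong2[of _ _ _ _ "(+)"] sum.cong) (simp_all add: mult_ac)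
  also have "\<dots> \<le> \<eta> 1 * b\<^sup>2 + 2 * b * (G\<^sup>2 / a) * (\<Sum>n. \<eta> (n + 1) * (1 - \<theta> (n + 1)))"
  proof (intro add_mono mult_left_mono)
    have "(\<Sum>n<N. \<eta> (Suc n) * (z (Suc n) - z n))
        \<le> \<eta> (Suc 0) * (b\<^sup>2 - z 0) - \<eta> (Suc N) * (b\<^sup>2 - z N)"
      by (rule sum_weighted_increments_le[where w = "\<lambda>n. \<eta> (Suc n)" and z = z, OF \<eta>(2) z(2)])
    moreover have "0 \<le> \<eta> (Suc N) * (b\<^sup>2 - z N)" "0 \<le> \<eta> (Suc 0) * z 0"
      using \<eta> z by (simp_all add: less_imp_le)
    ultimately show "(\<Sum>n<N. \<eta> (Suc n) * (z (Suc n) - z n)) \<le> \<eta> 1 * b\<^sup>2"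
      by (simp add: algebra_simps)
    show "(\<Sum>n<N. \<eta> (Suc n) * (1 - \<theta> (Suc n))) \<le> (\<Sum>n. \<eta> (n + 1) * (1 - \<theta> (n + 1)))"
      using sum_le_suminf[OF theta_summable, of "{..<N}"] \<eta> \<theta> by (simp add: less_imp_le)
    show "0 \<le> 2 * b * (G\<^sup>2 / a)"
      using a_pos b_pos by simp
  qed
  finally show "(\<Sum>n<N. \<eta> (Suc n) * err n i)
    \<le> \<eta> 1 * b\<^sup>2 + 2 * b * (G\<^sup>2 / a) * (\<Sum>n. \<eta> (n + 1) * (1 - \<theta> (n + 1)))" .
qed

lemma pathwise_descent:
  assumes "regular \<omega>"
  shows "f (x (Suc N) \<omega>) + (\<Sum>n<N. \<eta> (Suc n) * (\<Sum>i\<in>UNIV. p (Suc n) i \<omega> * s (Suc n) i \<omega>))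
    \<le> f x1 + L * (real CARD('d) * S)\<^sup>2 * (\<Sum>n<N. (\<eta> (Suc n))\<^sup>2)"
proof (induction N)
  case 0
  show ?case using assms init_x by (simp add: regular_def)
next
  case (Suc N)
  let ?y = "x (Suc N) \<omega>" and ?z = "x (Suc (Suc N)) \<omega>"
  have "f ?z \<le> f ?y + grad_f ?y \<bullet> (?z - ?y) + L * (norm (?z - ?y))\<^sup>2"
    using lipschitz_gradient_descent[OF gradient smooth] L_pos by (simp add: less_imp_le)
  moreover have "grad_f ?y \<bullet> (?z - ?y)
      = - (\<eta> (Suc N) * (\<Sum>i\<in>UNIV. p (Suc N) i \<omega> * s (Suc N) i \<omega>))"
    using assms by (simp add: inner_vec_def x_step regular_def p_def sum_distrib_left
        sum_negf[symmetric] mult_ac)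
  moreover have "L * (norm (?z - ?y))\<^sup>2 \<le> L * (\<eta> (Suc N) * (real CARD('d) * S))\<^sup>2"
    using step_norm[OF assms, of "Suc N"] L_pos by (intro mult_left_mono power_mono) auto
  ultimately show ?case
    using Suc by (simp add: power_mult_distrib algebra_simps)
qed

text \<open>Along a regular path the accumulated first-order decrease cannot exceed the gap between
  \<open>f x1\<close> and the infimum plus the summable quadratic errors; then take
  expectations.\<close>

lemma weighted_align_bounded: "\<exists>B. \<forall>N. (\<Sum>n<N. \<eta> (Suc n) * (\<Sum>i\<in>UNIV. align (Suc n) i)) \<le> B"
proof (intro exI allI)
  fix N
  let ?B = "f x1 - (INF y. f y) + L * (real CARD('d) * S)\<^sup>2 * (\<Sum>n. (\<eta> (n + 1))\<^sup>2)"
  let ?X = "\<lambda>\<omega>. \<Sum>n<N. \<eta> (Suc n) * (\<Sum>i\<in>UNIV. p (Suc n) i \<omega> * s (Suc n) i \<omega>)"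
  have int: "integrable M (\<lambda>\<omega>. p (Suc n) i \<omega> * s (Suc n) i \<omega>)" for n i
    by (intro M.ess_bounded_integrable ess_bounded_mult ess_bounded_p ess_bounded_s) simp
  have "?X \<omega> \<le> ?B" if "regular \<omega>" for \<omega>
  proof -
    have "(INF y. f y) \<le> f (x (Suc N) \<omega>)"
      by (rule cINF_lower[OF bounded_below]) simp
    moreover have "L * (real CARD('d) * S)\<^sup>2 * (\<Sum>n<N. (\<eta> (Suc n))\<^sup>2)
        \<le> L * (real CARD('d) * S)\<^sup>2 * (\<Sum>n. (\<eta> (n + 1))\<^sup>2)"
      using sum_le_suminf[OF squares_summable, of "{..<N}"] L_pos by (intro mult_left_mono) auto
    ultimately show ?thesis
      using pathwise_descent[OF that, of N] by linarith
  qed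
  then have "(\<integral>\<omega>. ?X \<omega> \<partial>M) \<le> ?B"
    using int by (intro M.integral_le_const regular_AE_I) auto
  also have "(\<integral>\<omega>. ?X \<omega> \<partial>M) = (\<Sum>n<N. \<eta> (Suc n) * (\<Sum>i\<in>UNIV. align (Suc n) i))"
    unfolding align_def using int by simp
  finally show "(\<Sum>n<N. \<eta> (Suc n) * (\<Sum>i\<in>UNIV. align (Suc n) i)) \<le> ?B" .
qed

text \<open>These products are the drift errors times their weights; they are dominated by sums of
  squares.\<close>

lemma weighted_step_products_bounded: "\<exists>B. \<forall>N. (\<Sum>n<N. \<eta> (Suc n) * \<bar>\<eta> n\<bar>) \<le> B"
proof (intro exI allI)
  fix N
  \<comment> \<open>The single unconstrained term \<open>\<eta> 0\<close> does not affect
    summability.\<close>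
  have summable: "summable (\<lambda>n. (\<eta> n)\<^sup>2)"
    using squares_summable by (subst summable_Suc_iff[symmetric]) simp
  have "(\<Sum>n<N. \<eta> (Suc n) * \<bar>\<eta> n\<bar>) \<le> (\<Sum>n<N. (\<eta> (n + 1))\<^sup>2 + (\<eta> n)\<^sup>2)"
  proof (rule sum_mono)
    fix n
    have "2 * (\<eta> (n + 1) * \<bar>\<eta> n\<bar>) \<le> (\<eta> (n + 1))\<^sup>2 + (\<eta> n)\<^sup>2"
      using sum_squares_bound[of "\<eta> (n + 1)" "\<bar>\<eta> n\<bar>"] by simp
    moreover have "0 \<le> \<eta> (n + 1) * \<bar>\<eta> n\<bar>"
      using step_size_pos[of "n + 1"] by simp
    ultimately show "\<eta> (Suc n) * \<bar>\<eta> n\<bar> \<le> (\<eta> (n + 1))\<^sup>2 + (\<eta> n)\<^sup>2" by simp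
  qed
  also have "\<dots> \<le> (\<Sum>n. (\<eta> (n + 1))\<^sup>2 + (\<eta> n)\<^sup>2)"
    by (intro sum_le_suminf summable_add squares_summable summable) auto
  finally show "(\<Sum>n<N. \<eta> (Suc n) * \<bar>\<eta> n\<bar>) \<le> (\<Sum>n. (\<eta> (n + 1))\<^sup>2 + (\<eta> n)\<^sup>2)" .
qed

section \<open>Summability of the weighted squared gradients\<close>

lemma sum_square_p: "(norm (grad_f (x k \<omega>)))\<^sup>2 = (\<Sum>i\<in>UNIV. (p k i \<omega>)\<^sup>2)"
  by (simp add: p_def norm_vec_def L2_set_def sum_nonneg)

lemma integrable_square_gradient:
  assumes "1 \<le> k" shows "integrable M (\<lambda>\<omega>. (norm (grad_f (x k \<omega>)))\<^sup>2)"
  unfolding sum_square_p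
  by (intro Bochner_Integration.integrable_sum M.ess_bounded_integrable ess_bounded_square
      ess_bounded_p assms)

text \<open>The descent inequality bounds the weighted alignments from above, and the momentum
  recursion bounds them from below by gains minus errors. With the errors bounded, so are the
  gains.\<close>

lemma expected_gradients_bounded:
  "\<exists>B. \<forall>N. (\<Sum>n<N. \<eta> (Suc n) * (\<integral>\<omega>. (norm (grad_f (x (Suc n) \<omega>)))\<^sup>2 \<partial>M)) \<le> B"
proof -
  define q where "q n = (\<integral>\<omega>. (norm (grad_f (x (Suc n) \<omega>)))\<^sup>2 \<partial>M)" for n
  define C1 where "C1 = (S / a)\<^sup>2 / (2 * c)"
  define C2 where "C2 = L * real CARD('d) * S\<^sup>2"
  define r where "r n = (\<Sum>i\<in>(UNIV::'d set). C1 * err n i + C2 * \<bar>\<eta> n\<bar>)" for n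
  define d where "d n = (\<Sum>i\<in>UNIV. align n i)" for n
  have C: "0 \<le> C1" "0 \<le> C2"
    using c_pos L_pos by (auto simp: C1_def C2_def)
  have \<eta>: "0 < \<eta> (Suc n)" "\<eta> (Suc (Suc n)) \<le> \<eta> (Suc n)" for n
    using step_size_pos[of "Suc n"] decreasing[of "Suc n"] by auto
  obtain B1 where B1: "\<And>i N. (\<Sum>n<N. \<eta> (Suc n) * err n i) \<le> B1 i"
    using weighted_err_bounded by metis
  obtain B2 where B2: "\<And>N. (\<Sum>n<N. \<eta> (Suc n) * \<bar>\<eta> n\<bar>) \<le> B2"
    using weighted_step_products_bounded by blast
  obtain B3 where B3: "\<And>N. (\<Sum>n<N. \<eta> (Suc n) * d (Suc n)) \<le> B3"
    using weighted_align_bounded unfolding d_def by blast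
  have q: "q n = (\<Sum>i\<in>UNIV. \<integral>\<omega>. (p (Suc n) i \<omega>)\<^sup>2 \<partial>M)" for n
    unfolding q_def sum_square_p
    by (intro Bochner_Integration.integral_sum M.ess_bounded_integrable ess_bounded_square
        ess_bounded_p) simp
  \<comment> \<open>The coordinates are added up first, because descent of \<open>f\<close> bounds
    only their total alignment from above.\<close>
  have recursion: "\<beta> (Suc n) * d n + c / 2 * q n - r n \<le> d (Suc n)" for n
  proof -
    have "\<beta> (Suc n) * d n + c / 2 * q n - r n
        = (\<Sum>i\<in>UNIV. \<beta> (Suc n) * align n i + c / 2 * (\<integral>\<omega>. (p (Suc n) i \<omega>)\<^sup>2 \<partial>M)
          - (C1 * err n i + C2 * \<bar>\<eta> n\<bar>))"
      unfolding d_def q r_def by (simp add: sum_distrib_left sum.distrib sum_subtractf)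
    also have "\<dots> \<le> d (Suc n)"
      unfolding d_def C1_def C2_def by (intro sum_mono align_recursion)
    finally show ?thesis .
  qed
  have err_nonneg: "0 \<le> err n i" for n i
    by (simp add: err_def)
  have "(\<Sum>n<N. \<eta> (Suc n) * q n)
      \<le> (B3 + (\<Sum>i\<in>(UNIV::'d set). C1 * B1 i + C2 * B2) / (1 - \<beta>bar)) / (c / 2)" for N
  proof -
    have "(\<Sum>n<N. \<eta> (Suc n) * (c / 2 * q n))
        \<le> (\<Sum>n<N. \<eta> (Suc n) * d (Suc n)) + (\<Sum>n<N. \<eta> (Suc n) * r n) / (1 - \<beta>bar)"
    proof (rule momentum_sum_bound[where \<beta> = "\<lambda>n. \<beta> (Suc n)"])
      show "0 \<le> c / 2 * q n" for n using c_pos by (simp add: q_def)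
      show "0 \<le> r n" for n unfolding r_def using C err_nonneg by (intro sum_nonneg) simp
      show "0 \<le> d 0" by (simp add: d_def align_0)
    qed (use \<eta> recursion beta_bar beta_facts[of "Suc _"] in \<open>auto intro: less_imp_le\<close>)
    moreover have "(\<Sum>n<N. \<eta> (Suc n) * r n) \<le> (\<Sum>i\<in>(UNIV::'d set). C1 * B1 i + C2 * B2)"
    proof -
      have "(\<Sum>n<N. \<eta> (Suc n) * r n)
          = (\<Sum>i\<in>(UNIV::'d set). \<Sum>n<N. \<eta> (Suc n) * (C1 * err n i + C2 * \<bar>\<eta> n\<bar>))"
        unfolding r_def sum_distrib_left by (rule sum.swap)
      also have "\<dots> = (\<Sum>i\<in>(UNIV::'d set). C1 * (\<Sum>n<N. \<eta> (Suc n) * err n i)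
          + C2 * (\<Sum>n<N. \<eta> (Suc n) * \<bar>\<eta> n\<bar>))"
        unfolding sum_distrib_left sum.distrib[symmetric]
        by (intro sum.cong) (simp_all add: algebra_simps)
      also have "\<dots> \<le> (\<Sum>i\<in>(UNIV::'d set). C1 * B1 i + C2 * B2)"
        using C B1 B2 by (intro sum_mono add_mono mult_left_mono)
      finally show ?thesis .
    qed
    then have "(\<Sum>n<N. \<eta> (Suc n) * r n) / (1 - \<beta>bar)
        \<le> (\<Sum>i\<in>(UNIV::'d set). C1 * B1 i + C2 * B2) / (1 - \<beta>bar)"
      using beta_bar by (intro divide_right_mono) auto
    moreover have "(\<Sum>n<N. \<eta> (Suc n) * (c / 2 * q n)) = c / 2 * (\<Sum>n<N. \<eta> (Suc n) * q n)"
      by (simp add: sum_distrib_left mult_ac)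
    ultimately have "c / 2 * (\<Sum>n<N. \<eta> (Suc n) * q n)
        \<le> B3 + (\<Sum>i\<in>(UNIV::'d set). C1 * B1 i + C2 * B2) / (1 - \<beta>bar)"
      using B3[of N] by linarith
    then show ?thesis
      using c_pos by (simp add: pos_le_divide_eq mult.commute)
  qed
  then show ?thesis unfolding q_def by blast
qed

text \<open>Monotone convergence: a nonnegative series with bounded expected partial sums has a
  finite expected sum, hence is finite almost surely. Extended nonnegative reals give the sum a
  meaning before convergence is known.\<close>

lemma weighted_gradients_summable:
  "AE \<omega> in M. summable (\<lambda>n. \<eta> (Suc n) * (norm (grad_f (x (Suc n) \<omega>)))\<^sup>2)"
proof -
  define h where "h n \<omega> = \<eta> (Suc n) * (norm (grad_f (x (Suc n) \<omega>)))\<^sup>2" for n \<omega>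
  have int: "integrable M (h n)" for n
    unfolding h_def using integrable_square_gradient[of "Suc n"] by simp
  have h: "0 \<le> h n \<omega>" for n \<omega>
    unfolding h_def using step_size_pos[of "Suc n"] by simp
  obtain B where B: "(\<Sum>n<N. \<integral>\<omega>. h n \<omega> \<partial>M) \<le> B" for N
    using expected_gradients_bounded unfolding h_def by auto
  have "(\<integral>\<^sup>+\<omega>. (\<Sum>n. ennreal (h n \<omega>)) \<partial>M) = (\<Sum>n. \<integral>\<^sup>+\<omega>. ennreal (h n \<omega>) \<partial>M)"
    using int by (intro nn_integral_suminf) (auto dest: borel_measurable_integrable)
  also have "\<dots> = (\<Sum>n. ennreal (\<integral>\<omega>. h n \<omega> \<partial>M))"
    using int h by (intro suminf_cong nn_integral_eq_integral) auto
  also have "\<dots> \<le> ennreal B"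
    using h by (intro suminf_le_const) (auto intro!: ennreal_leI B simp: sum_ennreal)
  finally have "(\<integral>\<^sup>+\<omega>. (\<Sum>n. ennreal (h n \<omega>)) \<partial>M) \<noteq> \<infinity>"
    by (auto simp: top_unique)
  moreover have "(\<lambda>\<omega>. \<Sum>n. ennreal (h n \<omega>)) \<in> borel_measurable M"
    using borel_measurable_integrable[OF int] by measurable
  ultimately have "AE \<omega> in M. (\<Sum>n. ennreal (h n \<omega>)) \<noteq> \<infinity>"
    by (intro nn_integral_noteq_infinite)
  then have "AE \<omega> in M. summable (\<lambda>n. h n \<omega>)"
    by eventually_elim (use h in \<open>auto intro: summable_suminf_not_top\<close>)
  then show ?thesis unfolding h_def .
qed

end

theorem theorem9:
  fixes M :: "'w measure" and P :: "'s measure"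
    and loss :: "real ^ 'd \<Rightarrow> 's \<Rightarrow> real"
    and f :: "real ^ 'd \<Rightarrow> real"
    and grad_f :: "real ^ 'd \<Rightarrow> real ^ 'd"
    and \<xi> :: "nat \<Rightarrow> 'w \<Rightarrow> 's"
    and \<eta> \<beta> \<theta> :: "nat \<Rightarrow> real"
    and \<epsilon> \<beta>bar G L :: real
    and x1 :: "real ^ 'd"
    and g m v x :: "nat \<Rightarrow> 'w \<Rightarrow> real ^ 'd"
  assumes adam: "adam M P loss f \<xi> \<eta> \<epsilon> \<beta> \<beta>bar \<theta> x1 g m v x"
    and gradient: "\<And>y. GDERIV f y :> grad_f y"
    and unbiased: "\<And>k. 1 \<le> k \<Longrightarrow>
          AE \<omega> in M. vec_cond_exp M (past_sigma M x k) (g k) \<omega> = grad_f (x k \<omega>)"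
    and G_pos: "0 < G"
    and bounded: "\<And>k. 1 \<le> k \<Longrightarrow> AE \<omega> in M. norm (g k \<omega>) \<le> G"
    and bounded_below: "bdd_below (range f)"
    and L_pos: "0 < L"
    and smooth: "\<And>y z. norm (grad_f y - grad_f z) \<le> L * norm (y - z)"
    and decreasing: "\<And>k. 1 \<le> k \<Longrightarrow> \<eta> (k + 1) \<le> \<eta> k"
    and ratio_diverges:
      "filterlim (\<lambda>N. \<Sum>k=2..N. \<eta> k / (\<Sum>i=1..k-1. \<eta> i)) at_top sequentially"
    and squares_summable: "summable (\<lambda>k. (\<eta> (k + 1))\<^sup>2)"
    and theta_summable: "summable (\<lambda>k. \<eta> (k + 1) * (1 - \<theta> (k + 1)))"
  shows "AE \<omega> in M.
    (\<lambda>K. Min ((\<lambda>k. (norm (grad_f (x k \<omega>)))\<^sup>2) ` {1..K})) \<in>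
      o[sequentially](\<lambda>K. 1 / (\<Sum>k=1..K. \<eta> k))"
proof -
  interpret bounded_adam M P loss f \<xi> \<eta> \<epsilon> \<beta> \<beta>bar \<theta> x1 g m v x grad_f G L
    by (intro bounded_adam.intro adam bounded_adam_axioms.intro gradient unbiased G_pos bounded
        bounded_below L_pos smooth decreasing squares_summable theta_summable)
  \<comment> \<open>The ratio condition forces the step sizes to have a divergent sum, which turns
    the convergent weighted series into the rate.\<close>
  have "filterlim (\<lambda>K. \<Sum>k=1..K. \<eta> k) at_top sequentially"
    by (rule partial_sums_at_top[OF step_size_pos ratio_diverges])
  then show ?thesis
    using weighted_gradients_summable
    by (elim eventually_mono) (intro running_Min_smallo step_size_pos, auto)
qed

end
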